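(* The Fréchet space $\mathcal{H}(\Omega)$ is the topological direct sum of its closed subspaces $\mathcal{H}_-(\Omega)$ and $\mathcal{H}_+(\Omega)$: $$\mathcal{H}(\Omega)=\mathcal{H}_-(\Omega)\oplus\mathcal{H}_+(\Omega).$$
   Context: $\hat{\mathbb{C}}=\mathbb{C}\cup\{\infty\}$ is the Riemann sphere, with conventions $z\cdot\infty=\infty\cdot z=\infty$ for $z\in\hat{\mathbb{C}}\setminus\{0\}$ and $0\cdot\infty=\infty\cdot 0=1$. $\Omega:=\{(z,w)\in\hat{\mathbb{C}}^2: z\cdot w\neq 1\}$, an open subset of $\hat{\mathbb{C}}^2$ and hence a complex manifold of dimension 2. $\mathcal{H}(\Omega)$ is the Fréchet space of all holomorphic functions $\Omega\to\mathbb{C}$ with the topology of locally uniform convergence (compact-open topology). For $p,q\in\mathbb{N}_0$ let $f_{p,q}:\Omega\to\mathbb{C}$ be the holomorphic function given by $f_{p,q}(z,w)=\dfrac{z^pw^q}{(1-zw)^{\max\{p,q\}}}$ for $(z,w)\in\Omega\cap\mathbb{C}^2$ and extended holomorphically to all of $\Omega$. $\mathcal{H}_-(\Omega)$ (the "past") is the closure in $\mathcal{H}(\Omega)$ of the set of finite linear combinations of the functions $f_{p,q}$ with $0\le q\le p<\infty$. $\mathcal{H}_+(\Omega)$ (the "future") is the closure in $\mathcal{H}(\Omega)$ of the set of finite linear combinations of the functions $f_{p,q}$ with $0\le p<q<\infty$. *)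

theory Defs
  imports "HOL-Analysis.Analysis" "HOL-Library.Function_Algebras"
begin

global_interpretation cfun: vector_space "\<lambda>(c::complex) (f :: 'a \<Rightarrow> complex) x. c * f x"
  by unfold_locales (auto simp: fun_eq_iff algebra_simps)

text \<open>
  The topology is understood to be carried by a linear subspace of the function space; the
  algebraic direct sum decomposition is bijectivity of addition on \<open>A \<times> B\<close>, and the continuity of
  its inverse is the continuity of the two projections.
\<close>

definition topological_direct_sum ::
  "('a \<Rightarrow> complex) topology \<Rightarrow> ('a \<Rightarrow> complex) set \<Rightarrow> ('a \<Rightarrow> complex) set \<Rightarrow> bool" where
  "topological_direct_sum T A B \<longleftrightarrow>
     cfun.subspace A \<and> cfun.subspace B \<and> closedin T A \<and> closedin T B \<and>
     homeomorphic_map (prod_topology (subtopology T A) (subtopology T B)) T (\<lambda>(f, g). f + g)"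

text \<open>\<open>None\<close> is the point at infinity.\<close>

type_synonym sphere = "complex option"

definition sphere_topology :: "sphere topology" where
  "sphere_topology = Alexandroff_compactification euclidean"

text \<open>Note the convention \<open>0 \<cdot> \<infinity> = \<infinity> \<cdot> 0 = 1\<close>.\<close>

fun sphere_mult :: "sphere \<Rightarrow> sphere \<Rightarrow> sphere" where
  "sphere_mult (Some z) (Some w) = Some (z * w)"
| "sphere_mult (Some z) None = (if z = 0 then Some 1 else None)"
| "sphere_mult None (Some w) = (if w = 0 then Some 1 else None)"
| "sphere_mult None None = None"

definition Omega :: "(sphere \<times> sphere) set" where
  "Omega = {(z, w). sphere_mult z w \<noteq> Some 1}"

definition Omega_topology :: "(sphere \<times> sphere) topology" where
  "Omega_topology = subtopology (prod_topology sphere_topology sphere_topology) Omega"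

text \<open>
  The inverses of the two standard charts of the sphere, both defined on all of the complex plane:
  the inclusion \<open>Some\<close>, and \<open>u \<mapsto> 1/u\<close> with \<open>0 \<mapsto> \<infinity>\<close>.
\<close>

definition chart_inf :: "complex \<Rightarrow> sphere" where
  "chart_inf u = (if u = 0 then None else Some (1 / u))"

text \<open>
  Holomorphy on an open subset \<open>D\<close> of the product of two spheres, viewed as a complex manifold: in
  each of the four product charts the function is complex differentiable, i.e. has a Frechet
  derivative which is complex linear on pairs of complex numbers.
\<close>

definition holomorphic_on_sphere2 ::
  "(sphere \<times> sphere \<Rightarrow> complex) \<Rightarrow> (sphere \<times> sphere) set \<Rightarrow> bool" where
  "holomorphic_on_sphere2 f D \<longleftrightarrow>
     (\<forall>\<phi> \<in> {Some, chart_inf}. \<forall>\<psi> \<in> {Some, chart_inf}. \<forall>u v. (\<phi> u, \<psi> v) \<in> D \<longrightarrow>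
        (\<exists>a b. ((\<lambda>(s, t). f (\<phi> s, \<psi> t)) has_derivative (\<lambda>(h, k). a * h + b * k)) (at (u, v))))"

text \<open>
  Functions on \<open>\<Omega>\<close> are represented by total functions vanishing outside \<open>\<Omega>\<close>, so that equality
  and the pointwise operations are those of functions on \<open>\<Omega>\<close>.
\<close>

definition Hol :: "(sphere \<times> sphere \<Rightarrow> complex) set" where
  "Hol = {f. holomorphic_on_sphere2 f Omega \<and> (\<forall>x. x \<notin> Omega \<longrightarrow> f x = 0)}"

text \<open>The compact-open topology; \<open>K = {}\<close> shows that its carrier is all of \<open>Hol\<close>.\<close>

definition Hol_topology :: "(sphere \<times> sphere \<Rightarrow> complex) topology" where
  "Hol_topology = topology_generated_by
     {{f \<in> Hol. f ` K \<subseteq> U} | K U. compactin Omega_topology K \<and> open U}"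

lemma topspace_Hol_topology: "topspace Hol_topology = Hol"
proof -
  have "Hol \<in> {{f \<in> Hol. f ` K \<subseteq> U} | K U. compactin Omega_topology K \<and> open U}"
    by (rule CollectI, rule exI[of _ "{}"], rule exI[of _ UNIV]) auto
  then show ?thesis
    unfolding Hol_topology_def topology_generated_by_topspace by blast
qed

text \<open>
  The holomorphic extension of the given formula from the finite points of \<open>\<Omega>\<close>; it is unique because
  the finite points are dense in \<open>\<Omega>\<close>.
\<close>

definition fpq :: "nat \<Rightarrow> nat \<Rightarrow> sphere \<times> sphere \<Rightarrow> complex" where
  "fpq p q = (THE f. f \<in> Hol \<and>
     (\<forall>z w. z * w \<noteq> 1 \<longrightarrow> f (Some z, Some w) = z ^ p * w ^ q / (1 - z * w) ^ max p q))"

definition Hol_minus :: "(sphere \<times> sphere \<Rightarrow> complex) set" where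
  "Hol_minus = Hol_topology closure_of cfun.span {fpq p q | p q. q \<le> p}"

definition Hol_plus :: "(sphere \<times> sphere \<Rightarrow> complex) set" where
  "Hol_plus = Hol_topology closure_of cfun.span {fpq p q | p q. p < q}"

end

theory Submission
  imports Defs "HOL-Complex_Analysis.Complex_Analysis"
begin

text \<open>
  Put \<open>a = z / (1 - zw)\<close>, \<open>b = w / (1 - zw)\<close> and \<open>c = zw / (1 - zw)\<close>. These functions are
  holomorphic on \<open>\<Omega>\<close>, satisfy \<open>ab = c(c + 1)\<close>, and \<open>f\<^sub>p\<^sub>q\<close> is \<open>a\<^sup>m c\<^sup>q\<close> with
  \<open>m = p - q\<close> if \<open>q \<le> p\<close>, and \<open>b\<^sup>m c\<^sup>p\<close> with \<open>m = q - p\<close> if \<open>p < q\<close>. The action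
  \<open>(z, w) \<mapsto> (\<lambda>z, w/\<lambda>)\<close> of the nonzero complex numbers on \<open>\<Omega>\<close> multiplies \<open>a\<close> by \<open>\<lambda>\<close> and \<open>b\<close> by
  \<open>1/\<lambda>\<close>, and leaves \<open>c\<close> invariant. So the past should consist of the nonnegative weights of this
  action, the future of the negative ones, and the theorem is a Laurent splitting along its orbits.

  To split a holomorphic function \<open>f\<close> on \<open>\<Omega>\<close>, restrict it to the points \<open>orbit_map \<lambda> c\<close>; these have
  first coordinate \<open>a = \<lambda>\<close>, and \<open>zw / (1 - zw)\<close> is the given number \<open>c\<close>. As a function of \<open>\<lambda> \<noteq> 0\<close> the restriction has a Laurent
  expansion. The sum of its terms of nonnegative degree is a Cauchy integral over a large circle
  (\<open>regular_part\<close>); it is an entire function \<open>E(\<lambda>, c)\<close> of two variables, because it is continuous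
  and entire in each variable (\<open>Osgood_entire\<close>). The projection onto the past is
  \<open>past_part f = E(a, c)\<close>.

  \<^item> It is continuous: on a compact set the coordinates \<open>a\<close> and \<open>c\<close> are bounded, so the Cauchy integrals
  involve \<open>f\<close> only on another compact set (\<open>past_part_bound\<close>).

  \<^item> It fixes \<open>a\<^sup>m c\<^sup>n\<close> and annihilates \<open>b\<^sup>m c\<^sup>n\<close> for \<open>m > 0\<close>. By continuity it is the identity on
  the past and zero on the future (\<open>past_part_closure\<close>).

  \<^item> Its values lie in the past, since entire functions of two variables are limits of polynomials,
  uniformly on bidiscs (\<open>entire2_polynomial_approximation\<close>).

  \<^item> The remainder \<open>f - past_part f\<close> lies in the future. Exchanging \<open>z\<close> and \<open>w\<close> exchanges \<open>a\<close> and \<open>b\<close> and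
  replaces \<open>\<lambda>\<close> by \<open>c(c + 1)/\<lambda>\<close>, which turns the negative powers of \<open>\<lambda>\<close> into positive ones
  (\<open>regular_part_reflect\<close>). So the remainder is \<open>E'(b, c) - E'(0, c)\<close> for an entire function
  \<open>E'\<close> (\<open>future_part_eq\<close>), a limit of polynomials in \<open>b\<close> and \<open>c\<close> without terms of degree \<open>0\<close> in \<open>b\<close>.

  Hence the past and the future are the image and the kernel of a continuous linear projection.
\<close>

section \<open>The regular part of a Laurent expansion\<close>

text \<open>
  The straight-line homotopy between the two circles stays in the closed annulus, so the integrals agree
  by Cauchy's theorem.
\<close>

lemma contour_integral_circlepath_annulus:
  assumes "0 < r" "r \<le> R" "open S" "h holomorphic_on S"
    and sub: "\<And>z. r \<le> norm z \<Longrightarrow> norm z \<le> R \<Longrightarrow> z \<in> S"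
  shows "contour_integral (circlepath 0 r) h = contour_integral (circlepath 0 R) h"
proof (rule Cauchy_theorem_homotopic_loops[OF _ assms(3,4)])
  show "homotopic_loops S (circlepath 0 r) (circlepath 0 R)"
  proof (rule homotopic_loops_linear)
    fix t :: real
    assume "t \<in> {0..1}"
    show "closed_segment (circlepath 0 r t) (circlepath 0 R t) \<subseteq> S"
    proof
      fix z assume "z \<in> closed_segment (circlepath 0 r t) (circlepath 0 R t)"
      then obtain u where u: "0 \<le> u" "u \<le> 1"
        and z: "z = (1 - u) *\<^sub>R circlepath 0 r t + u *\<^sub>R circlepath 0 R t"
        unfolding closed_segment_def by blast
      have "z = of_real ((1 - u) * r + u * R) * exp (2 * of_real pi * \<i> * of_real t)"
        unfolding z circlepath by (simp add: scaleR_conv_of_real algebra_simps)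
      moreover have "norm (exp (2 * of_real pi * \<i> * of_real t)) = 1"
        by simp
      moreover have "0 \<le> (1 - u) * r + u * R"
        using u assms(1,2) by simp
      ultimately have n: "norm z = (1 - u) * r + u * R"
        by (simp add: norm_mult del: of_real_add of_real_mult)
      have "(1 - u) * r + u * R = r + u * (R - r)" "(1 - u) * r + u * R = R - (1 - u) * (R - r)"
        by (auto simp: algebra_simps)
      moreover have "0 \<le> u * (R - r)" "0 \<le> (1 - u) * (R - r)"
        using u assms by auto
      ultimately show "z \<in> S"
        using n by (intro sub) linarith+
    qed
  qed auto
qed auto

lemma two_pi_i_nonzero: "2 * of_real pi * \<i> \<noteq> (0::complex)"
  by simp

text \<open>
  The sum of the terms of nonnegative degree in the Laurent expansion of \<open>F\<close> about \<open>0\<close>, as a function on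
  the whole plane. The radius \<open>norm \<mu> + 1\<close> is one choice of a circle around \<open>\<mu>\<close>; any larger
  circle gives the same value, see \<open>regular_part_circle\<close> below.
\<close>

definition regular_part :: "(complex \<Rightarrow> complex) \<Rightarrow> complex \<Rightarrow> complex" where
  "regular_part F \<mu> =
     contour_integral (circlepath 0 (norm \<mu> + 1)) (\<lambda>l. F l / (l - \<mu>)) / (2 * of_real pi * \<i>)"

lemma regular_part_cong:
  assumes "\<And>l. l \<noteq> 0 \<Longrightarrow> F l = G l"
  shows "regular_part F \<mu> = regular_part G \<mu>"
proof -
  have "contour_integral (circlepath 0 (norm \<mu> + 1)) (\<lambda>l. F l / (l - \<mu>)) =
      contour_integral (circlepath 0 (norm \<mu> + 1)) (\<lambda>l. G l / (l - \<mu>))"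
  proof (rule contour_integral_cong[OF refl])
    fix l assume l: "l \<in> path_image (circlepath 0 (norm \<mu> + 1))"
    have "l \<noteq> 0"
    proof
      assume "l = 0"
      then have "norm \<mu> + 1 = 0"
        using l by simp
      then show False
        using norm_ge_zero[of \<mu>] by linarith
    qed
    then show "F l / (l - \<mu>) = G l / (l - \<mu>)"
      by (simp add: assms)
  qed
  then show ?thesis
    by (simp only: regular_part_def)
qed

lemma regular_part_circle:
  assumes F: "F holomorphic_on - {0}" and R: "norm \<mu> < R"
  shows "regular_part F \<mu> = contour_integral (circlepath 0 R) (\<lambda>l. F l / (l - \<mu>)) / (2 * of_real pi * \<i>)"
proof -
  have *: "contour_integral (circlepath 0 r) (\<lambda>l. F l / (l - \<mu>)) =
      contour_integral (circlepath 0 s) (\<lambda>l. F l / (l - \<mu>))" if "norm \<mu> < r" "r \<le> s" for r s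
  proof (rule contour_integral_circlepath_annulus[where S = "- {0, \<mu>}"])
    show "(\<lambda>l. F l / (l - \<mu>)) holomorphic_on - {0, \<mu>}"
      by (intro holomorphic_intros holomorphic_on_subset[OF F]) auto
    show "0 < r"
      using that norm_ge_zero[of \<mu>] by linarith
    show "z \<in> - {0, \<mu>}" if "r \<le> norm z" "norm z \<le> s" for z
      using that \<open>0 < r\<close> \<open>norm \<mu> < r\<close> by auto
  qed (use that in auto)
  have "contour_integral (circlepath 0 (norm \<mu> + 1)) (\<lambda>l. F l / (l - \<mu>)) =
      contour_integral (circlepath 0 R) (\<lambda>l. F l / (l - \<mu>))"
  proof (cases "norm \<mu> + 1 \<le> R")
    case True
    then show ?thesis
      by (rule *[rotated]) simp
  next
    case False
    then show ?thesis
      by (intro *[symmetric] R) simp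
  qed
  then show ?thesis
    by (simp only: regular_part_def)
qed

lemma Cauchy_kernel_integrable:
  assumes "continuous_on (sphere 0 R) F" "norm \<mu> < R"
  shows "(\<lambda>l. F l / (l - \<mu>)) contour_integrable_on circlepath 0 R"
proof -
  have "0 < R"
    using assms norm_ge_zero[of \<mu>] by linarith
  then show ?thesis
    using assms by (intro contour_integrable_continuous_circlepath continuous_intros) auto
qed

lemma punctured_continuous_on_sphere:
  assumes "F holomorphic_on - {0}" "0 < R"
  shows "continuous_on (sphere 0 R) F"
  by (rule holomorphic_on_imp_continuous_on, rule holomorphic_on_subset[OF assms(1)])
    (use assms(2) in auto)

lemma regular_part_has_contour_integral:
  assumes F: "F holomorphic_on - {0}" and R: "norm \<mu> < R"
  shows "((\<lambda>l. F l / (l - \<mu>)) has_contour_integral 2 * of_real pi * \<i> * regular_part F \<mu>) (circlepath 0 R)"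
proof -
  have "0 < R"
    using R norm_ge_zero[of \<mu>] by linarith
  have eq: "2 * of_real pi * \<i> * regular_part F \<mu> = contour_integral (circlepath 0 R) (\<lambda>l. F l / (l - \<mu>))"
    unfolding regular_part_circle[OF assms] by simp
  show ?thesis
    unfolding eq
    by (rule has_contour_integral_integral
        [OF Cauchy_kernel_integrable[OF punctured_continuous_on_sphere[OF F \<open>0 < R\<close>] R]])
qed

lemma regular_partI:
  assumes "((\<lambda>l. F l / (l - \<mu>)) has_contour_integral 2 * of_real pi * \<i> * y) (circlepath 0 (norm \<mu> + 1))"
  shows "regular_part F \<mu> = y"
  unfolding regular_part_def contour_integral_unique[OF assms] by simp

lemma regular_part_add:
  assumes "F holomorphic_on - {0}" "G holomorphic_on - {0}"
  shows "regular_part (\<lambda>l. F l + G l) \<mu> = regular_part F \<mu> + regular_part G \<mu>"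
proof -
  let ?R = "norm \<mu> + 1"
  have "((\<lambda>l. F l / (l - \<mu>) + G l / (l - \<mu>)) has_contour_integral
     (2 * of_real pi * \<i> * regular_part F \<mu> + 2 * of_real pi * \<i> * regular_part G \<mu>)) (circlepath 0 ?R)"
    by (rule has_contour_integral_add; rule regular_part_has_contour_integral) (simp_all add: assms)
  then show ?thesis
    by (intro regular_partI) (simp only: add_divide_distrib distrib_left)
qed

lemma regular_part_cmult:
  assumes "F holomorphic_on - {0}"
  shows "regular_part (\<lambda>l. a * F l) \<mu> = a * regular_part F \<mu>"
proof -
  let ?R = "norm \<mu> + 1"
  have "((\<lambda>l. a * (F l / (l - \<mu>))) has_contour_integral
     a * (2 * of_real pi * \<i> * regular_part F \<mu>)) (circlepath 0 ?R)"
    by (rule has_contour_integral_lmul, rule regular_part_has_contour_integral) (simp_all add: assms)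
  then show ?thesis
    by (intro regular_partI) (simp only: times_divide_eq_right mult.left_commute[of a])
qed

lemma regular_part_bound:
  assumes F: "F holomorphic_on - {0}" and R: "norm \<mu> + 1 \<le> R"
    and B: "\<And>l. norm l = R \<Longrightarrow> norm (F l) \<le> B"
  shows "norm (regular_part F \<mu>) \<le> R * B"
proof -
  have "0 < R"
    using R norm_ge_zero[of \<mu>] by linarith
  have "0 \<le> B"
    using order_trans[OF norm_ge_zero B[of "of_real R"]] \<open>0 < R\<close> by simp
  have "norm (2 * of_real pi * \<i> * regular_part F \<mu>) \<le> B * (2 * pi * R)"
  proof (rule has_contour_integral_bound_circlepath[OF regular_part_has_contour_integral])
    show "norm \<mu> < R"
      using R by simp
    show "norm (F l / (l - \<mu>)) \<le> B" if "norm (l - 0) = R" for l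
    proof -
      have "1 \<le> norm (l - \<mu>)"
        using norm_triangle_ineq2[of l \<mu>] that R by simp
      then have "norm (F l) / norm (l - \<mu>) \<le> norm (F l)"
        using mult_left_mono[of 1 "norm (l - \<mu>)" "norm (F l)"] by (simp add: divide_le_eq)
      then show ?thesis
        using B[of l] that by (simp add: norm_divide)
    qed
  qed (use F \<open>0 \<le> B\<close> \<open>0 < R\<close> in auto)
  then have "(2 * pi) * norm (regular_part F \<mu>) \<le> (2 * pi) * (R * B)"
    by (simp add: norm_mult algebra_simps)
  then show ?thesis
    by (rule mult_left_le_imp_le) simp
qed

lemma holomorphic_regular_part:
  assumes F: "F holomorphic_on - {0}"
  shows "regular_part F holomorphic_on UNIV"
proof -
  have "regular_part F field_differentiable at \<mu>" for \<mu>
  proof -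
    let ?R = "norm \<mu> + 1"
    have "((\<lambda>w. 2 * of_real pi * \<i> * regular_part F w) has_field_derivative
        (of_nat 1 * contour_integral (circlepath 0 ?R) (\<lambda>u. F u / (u - \<mu>) ^ Suc 1))) (at \<mu>)"
    proof (rule Cauchy_next_derivative_circlepath(2))
      show "continuous_on (path_image (circlepath 0 ?R)) F"
        using punctured_continuous_on_sphere[OF F, of ?R]
        by (simp add: add_nonneg_pos)
      show "((\<lambda>u. F u / (u - w) ^ 1) has_contour_integral 2 * of_real pi * \<i> * regular_part F w)
          (circlepath 0 ?R)" if "w \<in> ball 0 ?R" for w
        using regular_part_has_contour_integral[OF F, of w ?R] that by simp
    qed auto
    then have "(\<lambda>w. 2 * of_real pi * \<i> * regular_part F w) field_differentiable at \<mu>"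
      unfolding field_differentiable_def by blast
    then show ?thesis
      using field_differentiable_divide[of "\<lambda>w. 2 * of_real pi * \<i> * regular_part F w" \<mu> UNIV
          "\<lambda>_. 2 * of_real pi * \<i>", OF _ field_differentiable_const two_pi_i_nonzero]
      unfolding nonzero_mult_div_cancel_left[OF two_pi_i_nonzero] by iprover
  qed
  then show ?thesis
    by (simp add: holomorphic_on_def)
qed

text \<open>
  Cauchy's formula for an annulus: the divided difference of \<open>F\<close> at \<open>\<mu>\<close> is holomorphic on the
  punctured plane, so it has the same integral over the unit circle as over a circle around \<open>\<mu>\<close>, whereas
  \<open>1 / (l - \<mu>)\<close> has integral \<open>0\<close> over the former and \<open>2\<pi>\<i>\<close> over the latter.
\<close>

lemma regular_part_eq_annulus:
  assumes F: "F holomorphic_on - {0}" and \<mu>: "1 < norm \<mu>"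
  shows "F \<mu> = regular_part F \<mu> -
    contour_integral (circlepath 0 1) (\<lambda>l. F l / (l - \<mu>)) / (2 * of_real pi * \<i>)"
proof -
  let ?R = "norm \<mu> + 1"
  define h where "h l = (if l = \<mu> then deriv F \<mu> else (F l - F \<mu>) / (l - \<mu>))" for l
  have "\<mu> \<noteq> 0"
    using \<mu> by auto
  have h: "h holomorphic_on - {0}"
    unfolding h_def by (rule pole_lemma_open[OF F]) auto
  have eq: "contour_integral (circlepath 0 1) h = contour_integral (circlepath 0 ?R) h"
    by (rule contour_integral_circlepath_annulus[OF _ _ _ h]) auto
  have int: "contour_integral (circlepath 0 R) h =
      contour_integral (circlepath 0 R) (\<lambda>l. F l / (l - \<mu>))
      - F \<mu> * contour_integral (circlepath 0 R) (\<lambda>l. 1 / (l - \<mu>))" if R: "0 < R" "R \<noteq> norm \<mu>" for R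
  proof -
    have "contour_integral (circlepath 0 R) h =
      contour_integral (circlepath 0 R) (\<lambda>l. F l / (l - \<mu>) - F \<mu> * (1 / (l - \<mu>)))"
      using R by (intro contour_integral_cong) (auto simp: h_def diff_divide_distrib)
    also have "\<dots> = contour_integral (circlepath 0 R) (\<lambda>l. F l / (l - \<mu>))
      - contour_integral (circlepath 0 R) (\<lambda>l. F \<mu> * (1 / (l - \<mu>)))"
      using R punctured_continuous_on_sphere[OF F R(1)]
      by (intro contour_integral_diff contour_integrable_continuous_circlepath continuous_intros) auto
    also have "contour_integral (circlepath 0 R) (\<lambda>l. F \<mu> * (1 / (l - \<mu>))) =
       F \<mu> * contour_integral (circlepath 0 R) (\<lambda>l. 1 / (l - \<mu>))"
      using R
      by (intro contour_integral_lmul contour_integrable_continuous_circlepath continuous_intros) auto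
    finally show ?thesis .
  qed
  have out: "contour_integral (circlepath 0 ?R) (\<lambda>l. 1 / (l - \<mu>)) = 2 * of_real pi * \<i>"
    using contour_integral_unique[OF Cauchy_integral_circlepath_simple[of "\<lambda>_. 1" 0 ?R \<mu>]] by simp
  have inn: "contour_integral (circlepath 0 1) (\<lambda>l. 1 / (l - \<mu>)) = 0"
  proof (rule contour_integral_unique, rule Cauchy_theorem_disc_simple)
    show "(\<lambda>l. 1 / (l - \<mu>)) holomorphic_on ball 0 (norm \<mu>)"
      by (intro holomorphic_intros) auto
  qed (use \<mu> in auto)
  have "contour_integral (circlepath 0 1) (\<lambda>l. F l / (l - \<mu>)) =
      2 * of_real pi * \<i> * regular_part F \<mu> - F \<mu> * (2 * of_real pi * \<i>)"
    using eq int[of 1] int[of ?R] out inn \<mu> contour_integral_unique[OF regular_part_has_contour_integral[OF F, of \<mu> ?R]]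
    by (simp add: add_nonneg_pos)
  then show ?thesis
    by (simp add: field_simps)
qed

text \<open>
  By Cauchy's formula for an annulus the difference \<open>F - regular_part F\<close> is, outside the unit disc, a
  Cauchy integral over the unit circle. It tends to \<open>0\<close> at infinity, so in the variable \<open>1/\<mu>\<close> the
  singularity at \<open>0\<close> is removable.
\<close>

lemma regular_part_remainder:
  assumes F: "F holomorphic_on - {0}"
  obtains r where "r holomorphic_on UNIV" "r 0 = 0"
    "\<And>\<mu>. \<mu> \<noteq> 0 \<Longrightarrow> F \<mu> = regular_part F \<mu> + r (1 / \<mu>)"
proof -
  define r where "r \<nu> = (if \<nu> = 0 then 0 else F (1 / \<nu>) - regular_part F (1 / \<nu>))" for \<nu>
  have inv: "(\<lambda>\<nu>::complex. 1 / \<nu>) holomorphic_on - {0}"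
    by (intro holomorphic_intros) auto
  have "(\<lambda>\<nu>. F (1 / \<nu>) - regular_part F (1 / \<nu>)) holomorphic_on - {0}"
    by (intro holomorphic_intros holomorphic_on_compose_gen[OF inv F, unfolded o_def]
      holomorphic_on_compose_gen[OF inv holomorphic_regular_part[OF F], unfolded o_def]) auto
  then have hol: "r holomorphic_on - {0}"
    by (rule holomorphic_transform) (simp add: r_def)
  have "compact (F ` sphere 0 1)"
    by (intro compact_continuous_image punctured_continuous_on_sphere F) auto
  then obtain B where B: "0 < B" "\<And>l. norm l = 1 \<Longrightarrow> norm (F l) \<le> B"
    using compact_imp_bounded bounded_pos by (metis imageI mem_sphere_0)
  have bound: "norm (r \<nu>) \<le> 2 * B * norm \<nu>" if "0 < norm \<nu>" "norm \<nu> < 1 / 2" for \<nu>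
  proof -
    let ?\<mu> = "1 / \<nu>" and ?I = "contour_integral (circlepath 0 1) (\<lambda>l. F l / (l - 1 / \<nu>))"
    have n\<mu>: "norm ?\<mu> = 1 / norm \<nu>"
      by (simp add: norm_divide)
    then have "2 < norm ?\<mu>"
      using that by (simp only: n\<mu> less_divide_eq) simp
    have *: "r \<nu> = - ?I / (2 * of_real pi * \<i>)"
      using regular_part_eq_annulus[OF F, of ?\<mu>] that \<open>2 < norm ?\<mu>\<close> by (auto simp: r_def)
    have "norm ?I \<le> (B / (norm ?\<mu> - 1)) * (2 * pi * 1)"
    proof (rule has_contour_integral_bound_circlepath[OF has_contour_integral_integral])
      show "(\<lambda>l. F l / (l - ?\<mu>)) contour_integrable_on circlepath 0 1"
        using punctured_continuous_on_sphere[OF F, of 1] \<open>2 < norm ?\<mu>\<close>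
        by (intro contour_integrable_continuous_circlepath continuous_intros) auto
      show "norm (F l / (l - ?\<mu>)) \<le> B / (norm ?\<mu> - 1)" if "norm (l - 0) = 1" for l
      proof -
        have "norm ?\<mu> - 1 \<le> norm (l - ?\<mu>)"
          using norm_triangle_ineq3[of l ?\<mu>] that by (simp add: norm_minus_commute)
        then show ?thesis
          unfolding norm_divide[of "F l"] using B that \<open>2 < norm ?\<mu>\<close> by (intro frac_le) auto
      qed
    qed (use B \<open>2 < norm ?\<mu>\<close> in auto)
    then have "norm (r \<nu>) \<le> B / (norm ?\<mu> - 1)"
      unfolding * by (simp add: norm_divide norm_mult field_simps)
    also have "\<dots> \<le> B / (norm ?\<mu> / 2)"
      using B \<open>2 < norm ?\<mu>\<close> by (intro divide_left_mono mult_pos_pos) auto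
    also have "\<dots> = 2 * B * norm \<nu>"
      by (simp add: norm_divide)
    finally show ?thesis .
  qed
  have "(r \<longlongrightarrow> 0) (at 0)"
  proof (rule Lim_null_comparison)
    show "\<forall>\<^sub>F \<nu> in at 0. norm (r \<nu>) \<le> 2 * B * norm \<nu>"
      unfolding eventually_at using bound by (intro exI[of _ "1/2"]) auto
    show "((\<lambda>\<nu>. 2 * B * norm \<nu>) \<longlongrightarrow> 0) (at (0::complex))"
      by (intro tendsto_eq_intros) auto
  qed
  with hol have "r holomorphic_on UNIV"
    using no_isolated_singularity'[of "{0}" r UNIV] by (simp add: r_def Compl_eq_Diff_UNIV)
  then show ?thesis
    by (rule that) (auto simp: r_def)
qed

text \<open>
  Two splittings into an entire function and an entire function of \<open>1/l\<close> that vanishes at infinity differ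
  by an entire function that tends to \<open>0\<close> at infinity. By Liouville's theorem they agree.
\<close>

lemma regular_part_unique:
  assumes E: "E holomorphic_on UNIV" and r: "r holomorphic_on UNIV" "r 0 = 0"
    and F: "\<And>l. l \<noteq> 0 \<Longrightarrow> F l = E l + r (1 / l)"
  shows "regular_part F \<mu> = E \<mu>"
proof -
  have inv: "(\<lambda>\<nu>::complex. 1 / \<nu>) holomorphic_on - {0}"
    by (intro holomorphic_intros) auto
  have "(\<lambda>l. E l + r (1 / l)) holomorphic_on - {0}"
    by (intro holomorphic_intros holomorphic_on_subset[OF E] 
        holomorphic_on_compose_gen[OF inv r(1), unfolded o_def]) auto
  then have hol: "F holomorphic_on - {0}"
    by (rule holomorphic_transform) (simp add: F)
  obtain s where s: "s holomorphic_on UNIV" "s 0 = 0"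
    "\<And>\<mu>. \<mu> \<noteq> 0 \<Longrightarrow> F \<mu> = regular_part F \<mu> + s (1 / \<mu>)"
    using regular_part_remainder[OF hol] by blast
  have "regular_part F \<mu> - E \<mu> = 0"
  proof (rule Liouville_weak_0[where f = "\<lambda>\<mu>. regular_part F \<mu> - E \<mu>"])
    show "(\<lambda>\<mu>. regular_part F \<mu> - E \<mu>) holomorphic_on UNIV"
      by (intro holomorphic_intros holomorphic_regular_part hol E)
    have lim: "((\<lambda>l. r (1 / l) - s (1 / l)) \<longlongrightarrow> 0 - 0) at_infinity"
    proof (intro tendsto_diff)
      have "isCont r 0" "isCont s 0"
        using r s by (metis UNIV_I continuous_on_eq_continuous_at holomorphic_on_imp_continuous_on open_UNIV)+
      moreover have "((\<lambda>l::complex. 1 / l) \<longlongrightarrow> 0) at_infinity"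
        using tendsto_inverse_0[where 'a = complex]
        by (rule filterlim_cong[THEN iffD1, rotated 3]) (simp_all add: inverse_eq_divide)
      ultimately show "((\<lambda>l. r (1 / l)) \<longlongrightarrow> 0) at_infinity" "((\<lambda>l. s (1 / l)) \<longlongrightarrow> 0) at_infinity"
        using isCont_tendsto_compose[of 0 r "\<lambda>l. 1 / l" at_infinity]
          isCont_tendsto_compose[of 0 s "\<lambda>l. 1 / l" at_infinity] unfolding r(2) s(2) by blast+
    qed
    have "\<forall>\<^sub>F l in at_infinity. r (1 / l) - s (1 / l) = regular_part F l - E l"
    proof (rule eventually_mono[OF eventually_not_equal_at_infinity[of 0]])
      fix l :: complex
      assume "l \<noteq> 0"
      have "E l + r (1 / l) = regular_part F l + s (1 / l)"
        using F[OF \<open>l \<noteq> 0\<close>] s(3)[OF \<open>l \<noteq> 0\<close>] by (rule trans[OF sym])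
      then show "r (1 / l) - s (1 / l) = regular_part F l - E l"
        by (simp add: algebra_simps)
    qed
    then show "((\<lambda>\<mu>. regular_part F \<mu> - E \<mu>) \<longlongrightarrow> 0) at_infinity"
      using lim tendsto_cong by force
  qed
  then show ?thesis
    by simp
qed

text \<open>
  The substitution \<open>l \<mapsto> k/l\<close> exchanges positive and negative powers. It thus presents the principal part
  of \<open>F\<close> as the regular part of the reflected function without its constant term.
\<close>

lemma regular_part_reflect:
  assumes F: "F holomorphic_on - {0}" and k: "k \<noteq> 0" and \<mu>: "\<mu> \<noteq> 0"
  shows "F \<mu> = regular_part F \<mu> +
    (regular_part (\<lambda>\<nu>. F (k / \<nu>)) (k / \<mu>) - regular_part (\<lambda>\<nu>. F (k / \<nu>)) 0)"
proof -
  obtain r where r: "r holomorphic_on UNIV" "r 0 = 0"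
    "\<And>\<mu>. \<mu> \<noteq> 0 \<Longrightarrow> F \<mu> = regular_part F \<mu> + r (1 / \<mu>)"
    using regular_part_remainder[OF F] by blast
  let ?E = "regular_part F"
  have "regular_part (\<lambda>\<nu>. F (k / \<nu>)) \<nu> = r (\<nu> / k) + ?E 0" for \<nu>
  proof (rule regular_part_unique[where r = "\<lambda>l. ?E (k * l) - ?E 0"])
    show "(\<lambda>\<nu>. r (\<nu> / k) + ?E 0) holomorphic_on UNIV"
      by (intro holomorphic_intros holomorphic_on_compose_gen[OF _ r(1), unfolded o_def])
        (use k in auto)
    show "(\<lambda>l. ?E (k * l) - ?E 0) holomorphic_on UNIV"
      by (intro holomorphic_intros
          holomorphic_on_compose_gen[OF _ holomorphic_regular_part[OF F], unfolded o_def]) auto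
    show "F (k / l) = r (l / k) + ?E 0 + (?E (k * (1 / l)) - ?E 0)" if "l \<noteq> 0" for l
      using r(3)[of "k / l"] k that by simp
  qed simp
  then show ?thesis
    using r(2) r(3)[OF \<mu>] k by simp
qed

section \<open>Functions of two complex variables\<close>

lemma continuous_on_contour_integral_circlepath:
  assumes "0 \<le> r" and K: "continuous_on (X \<times> sphere z r) (\<lambda>(x, l). K x l)"
  shows "continuous_on X (\<lambda>x. contour_integral (circlepath z r) (K x))"
proof -
  have img: "circlepath z r t \<in> sphere z r" if "t \<in> {0..1}" for t
    using that \<open>0 \<le> r\<close> by (metis imageI path_image_def path_image_circlepath_nonneg)
  have cont: "continuous_on {0..1} (circlepath z r)"
    using path_circlepath path_def by metis
  have "continuous_on (X \<times> cbox 0 1) (\<lambda>(x, t). K x (circlepath z r t) * vector_derivative (circlepath z r) (at t))"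
    unfolding vector_derivative_circlepath case_prod_unfold
    by (intro continuous_intros continuous_on_compose2[OF K[unfolded case_prod_unfold], 
          of _ "\<lambda>p. (fst p, circlepath z r (snd p))", simplified]
          continuous_on_compose2[OF cont]) (use img in auto)
  then have "continuous_on X (\<lambda>x. integral (cbox 0 1) (\<lambda>t. K x (circlepath z r t) * vector_derivative (circlepath z r) (at t)))"
    by (rule integral_continuous_on_param)
  then show ?thesis
    by (simp add: contour_integral_integral)
qed

text \<open>
  Cauchy's formula over a unit circle that moves with \<open>c\<close> writes the derivative as an integral of a
  jointly continuous function.
\<close>

lemma continuous_on_deriv_param:
  fixes K :: "'a::topological_space \<Rightarrow> complex \<Rightarrow> complex"
  assumes K: "continuous_on (X \<times> UNIV) (\<lambda>(x, c). K x c)"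
    and hol: "\<And>x. x \<in> X \<Longrightarrow> K x holomorphic_on UNIV"
  shows "continuous_on (X \<times> UNIV) (\<lambda>(x, c). deriv (K x) c)"
proof -
  \<comment> \<open>The circle is shifted to the origin, so that the path does not depend on \<open>c\<close>.\<close>
  have eq: "deriv (K x) c = 1 / (2 * of_real pi * \<i>) *
      contour_integral (circlepath 0 1) (\<lambda>u. K x (c + u) / u ^ 2)" if "x \<in> X" for x c
  proof -
    have "(\<lambda>u. K x (c + u)) holomorphic_on UNIV"
      by (rule holomorphic_on_compose_gen[OF _ hol[OF that], of "\<lambda>u. c + u" UNIV, unfolded o_def])
        (auto intro: holomorphic_intros)
    then have "((\<lambda>u. K x (c + u)) has_field_derivative
       (1 / (2 * of_real pi * \<i>) * contour_integral (circlepath 0 1) (\<lambda>u. K x (c + u) / (u - 0) ^ 2))) (at 0)"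
      by (intro Cauchy_derivative_integral_circlepath(2))
        (auto intro: holomorphic_on_imp_continuous_on holomorphic_on_subset)
    moreover have "((\<lambda>u. K x (c + u)) has_field_derivative deriv (K x) c) (at 0)"
      using hol[OF that] holomorphic_derivI[of "K x" UNIV c] DERIV_shift[of "K x" "deriv (K x) c" 0 c]
      by (simp add: add.commute)
    ultimately show ?thesis
      using DERIV_unique by force
  qed
  have "continuous_on ((X \<times> UNIV) \<times> sphere 0 1) (\<lambda>(p, u). K (fst p) (snd p + u) / u ^ 2)"
    unfolding case_prod_unfold
    by (intro continuous_intros continuous_on_compose2[OF K[unfolded case_prod_unfold],
          of _ "\<lambda>q. (fst (fst q), snd (fst q) + snd q)", simplified]) auto
  then have "continuous_on (X \<times> UNIV) (\<lambda>p. contour_integral (circlepath 0 1) (\<lambda>u. K (fst p) (snd p + u) / u ^ 2))"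
    by (intro continuous_on_contour_integral_circlepath) auto
  then have "continuous_on (X \<times> UNIV) (\<lambda>p. 1 / (2 * of_real pi * \<i>) *
     contour_integral (circlepath 0 1) (\<lambda>u. K (fst p) (snd p + u) / u ^ 2))"
    by (intro continuous_intros)
  then show ?thesis
    by (rule continuous_on_eq) (auto simp: eq)
qed

lemma holomorphic_contour_integral_param:
  assumes "0 \<le> r" and K: "continuous_on (sphere z r \<times> UNIV) (\<lambda>(l, c). K l c)"
    and hol: "\<And>l. l \<in> sphere z r \<Longrightarrow> K l holomorphic_on UNIV"
  shows "(\<lambda>c. contour_integral (circlepath z r) (\<lambda>l. K l c)) holomorphic_on UNIV"
proof -
  let ?g = "circlepath z r"
  let ?d = "\<lambda>t. vector_derivative ?g (at t)"
  have img: "?g t \<in> sphere z r" if "t \<in> {0..1}" for t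
    using that \<open>0 \<le> r\<close> by (metis imageI path_image_def path_image_circlepath_nonneg)
  have cont: "continuous_on {0..1} ?g"
    using path_circlepath path_def by metis
  have joint: "continuous_on (UNIV \<times> cbox 0 1) (\<lambda>(c, t). H (?g t) c * ?d t)"
    if "continuous_on (sphere z r \<times> UNIV) (\<lambda>(l, c). H l c)" for H
    unfolding vector_derivative_circlepath case_prod_unfold
    by (intro continuous_intros continuous_on_compose2[OF that[unfolded case_prod_unfold], 
          of _ "\<lambda>p. (?g (snd p), fst p)", simplified]
          continuous_on_compose2[OF cont]) (use img in auto)
  have "(\<lambda>c. integral (cbox 0 1) (\<lambda>t. K (?g t) c * ?d t)) holomorphic_on UNIV"
  proof (rule leibniz_rule_holomorphic)
    show "((\<lambda>c. K (?g t) c * ?d t) has_field_derivative deriv (K (?g t)) c * ?d t) (at c within UNIV)"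
      if "t \<in> cbox 0 1" for c t
      using that hol[OF img] holomorphic_derivI[of "K (?g t)" UNIV c]
      by (auto intro!: DERIV_cmult_right)
    show "continuous_on (UNIV \<times> cbox 0 1) (\<lambda>(c, t). deriv (K (?g t)) c * ?d t)"
      by (rule joint[OF continuous_on_deriv_param[OF K hol]])
    show "(\<lambda>t. K (?g t) c * ?d t) integrable_on cbox 0 1" for c
    proof (rule integrable_continuous)
      show "continuous_on (cbox 0 1) (\<lambda>t. K (?g t) c * ?d t)"
        using continuous_on_compose2[OF joint[OF K], of "cbox 0 1" "Pair c"]
        by (simp add: image_subset_iff continuous_on_Pair)
    qed
  qed auto
  then show ?thesis
    by (simp add: contour_integral_integral)
qed

text \<open>
  The local condition in the definition of holomorphy on \<open>\<Omega>\<close>, which in each chart is a statement about a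
  function of two complex variables.
\<close>

definition complex_differentiable2 :: "(complex \<times> complex \<Rightarrow> complex) \<Rightarrow> complex \<times> complex \<Rightarrow> bool" where
  "complex_differentiable2 F p \<longleftrightarrow> (\<exists>a b. (F has_derivative (\<lambda>(h, k). a * h + b * k)) (at p))"

lemma complex_differentiable2_compose:
  assumes F: "complex_differentiable2 F (g p, h p)"
    and g: "complex_differentiable2 g p" and h: "complex_differentiable2 h p"
  shows "complex_differentiable2 (\<lambda>q. F (g q, h q)) p"
proof -
  obtain a b c d m n where
    F: "(F has_derivative (\<lambda>(h, k). a * h + b * k)) (at (g p, h p))"
    and g: "(g has_derivative (\<lambda>(h, k). c * h + d * k)) (at p)"
    and h: "(h has_derivative (\<lambda>(h, k). m * h + n * k)) (at p)"
    using assms unfolding complex_differentiable2_def by blast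
  have "((\<lambda>q. F (g q, h q)) has_derivative
     (\<lambda>x. (\<lambda>(h, k). a * h + b * k) ((\<lambda>(h, k). c * h + d * k) x, (\<lambda>(h, k). m * h + n * k) x))) (at p)"
    by (rule has_derivative_compose[OF has_derivative_Pair[OF g h] F])
  moreover have "(\<lambda>x. (\<lambda>(h, k). a * h + b * k) ((\<lambda>(h, k). c * h + d * k) x, (\<lambda>(h, k). m * h + n * k) x)) =
     (\<lambda>(h, k). (a * c + b * m) * h + (a * d + b * n) * k)"
    by (auto simp: fun_eq_iff algebra_simps)
  ultimately show ?thesis
    unfolding complex_differentiable2_def by metis
qed

lemma complex_differentiable2_of_field_derivatives:
  assumes "(f has_field_derivative f') (at (g p))" "complex_differentiable2 g p"
  shows "complex_differentiable2 (\<lambda>q. f (g q)) p"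
proof -
  obtain a b where g: "(g has_derivative (\<lambda>(h, k). a * h + b * k)) (at p)"
    using assms(2) unfolding complex_differentiable2_def by blast
  have "((\<lambda>q. f (g q)) has_derivative (\<lambda>x. f' * ((\<lambda>(h, k). a * h + b * k) x))) (at p)"
    by (rule has_derivative_compose[OF g assms(1)[unfolded has_field_derivative_def]])
  moreover have "(\<lambda>x. f' * ((\<lambda>(h, k). a * h + b * k) x)) = (\<lambda>(h, k). (f' * a) * h + (f' * b) * k)"
    by (auto simp: fun_eq_iff algebra_simps)
  ultimately show ?thesis
    unfolding complex_differentiable2_def by metis
qed

named_theorems cd2_intros

lemma complex_differentiable2_const [cd2_intros]: "complex_differentiable2 (\<lambda>_. c) p"
  unfolding complex_differentiable2_def by (intro exI[of _ 0]) (simp add: case_prod_unfold)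

lemma complex_differentiable2_fst [cd2_intros]: "complex_differentiable2 fst p"
  unfolding complex_differentiable2_def
  by (rule exI[of _ 1], rule exI[of _ 0]) (auto simp: case_prod_unfold intro: has_derivative_fst)

lemma complex_differentiable2_snd [cd2_intros]: "complex_differentiable2 snd p"
  unfolding complex_differentiable2_def
  by (rule exI[of _ 0], rule exI[of _ 1]) (auto simp: case_prod_unfold intro: has_derivative_snd)

lemma complex_differentiable2_add [cd2_intros]:
  assumes "complex_differentiable2 f p" "complex_differentiable2 g p"
  shows "complex_differentiable2 (\<lambda>q. f q + g q) p"
proof -
  have "complex_differentiable2 (\<lambda>q. fst q + snd q) (f p, g p)"
    unfolding complex_differentiable2_def
    by (rule exI[of _ 1], rule exI[of _ 1]) (auto simp: case_prod_unfold intro!: derivative_eq_intros)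
  from complex_differentiable2_compose[OF this assms] show ?thesis
    by simp
qed

lemma complex_differentiable2_mult [cd2_intros]:
  assumes "complex_differentiable2 f p" "complex_differentiable2 g p"
  shows "complex_differentiable2 (\<lambda>q. f q * g q) p"
proof -
  have "complex_differentiable2 (\<lambda>q. fst q * snd q) (f p, g p)"
    unfolding complex_differentiable2_def
    by (rule exI[of _ "g p"], rule exI[of _ "f p"])
      (auto simp: case_prod_unfold algebra_simps intro!: derivative_eq_intros)
  from complex_differentiable2_compose[OF this assms] show ?thesis
    by simp
qed

lemma complex_differentiable2_diff [cd2_intros]:
  assumes "complex_differentiable2 f p" "complex_differentiable2 g p"
  shows "complex_differentiable2 (\<lambda>q. f q - g q) p"
  using complex_differentiable2_add[OF assms(1)
      complex_differentiable2_mult[OF complex_differentiable2_const[of "-1"] assms(2)]] by simp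

lemma complex_differentiable2_power [cd2_intros]:
  assumes "complex_differentiable2 f p"
  shows "complex_differentiable2 (\<lambda>q. f q ^ n) p"
  by (induction n) (auto intro: cd2_intros assms)

lemma complex_differentiable2_divide [cd2_intros]:
  assumes "complex_differentiable2 f p" "complex_differentiable2 g p" "g p \<noteq> 0"
  shows "complex_differentiable2 (\<lambda>q. f q / g q) p"
proof -
  have "complex_differentiable2 (\<lambda>q. inverse (g q)) p"
    by (rule complex_differentiable2_of_field_derivatives[OF DERIV_inverse[OF assms(3)] assms(2)])
  from complex_differentiable2_mult[OF assms(1) this] show ?thesis
    by (simp add: divide_inverse)
qed

lemma complex_differentiable2_imp_continuous:
  "complex_differentiable2 F p \<Longrightarrow> continuous (at p) F"
  unfolding complex_differentiable2_def by (blast intro: has_derivative_continuous)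

lemma complex_differentiable2_imp_fst:
  assumes "complex_differentiable2 F (z, w)"
  shows "(\<lambda>z. F (z, w)) field_differentiable at z"
proof -
  obtain a b where F: "(F has_derivative (\<lambda>(h, k). a * h + b * k)) (at (z, w))"
    using assms(1) unfolding complex_differentiable2_def by blast
  have "((\<lambda>s. F (s, w)) has_derivative (\<lambda>h. (\<lambda>(h, k). a * h + b * k) (h, 0))) (at z)"
    by (rule has_derivative_compose[where g = F and f = "\<lambda>s. (s, w)", OF _ F])
      (auto intro!: derivative_eq_intros)
  then have "((\<lambda>z. F (z, w)) has_field_derivative a) (at z)"
    by (simp add: has_field_derivative_def)
  then show ?thesis
    unfolding field_differentiable_def by blast
qed

lemma complex_differentiable2_imp_snd:
  assumes "complex_differentiable2 F (z, w)"
  shows "(\<lambda>w. F (z, w)) field_differentiable at w"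
proof -
  obtain a b where F: "(F has_derivative (\<lambda>(h, k). a * h + b * k)) (at (z, w))"
    using assms(1) unfolding complex_differentiable2_def by blast
  have "((\<lambda>s. F (z, s)) has_derivative (\<lambda>h. (\<lambda>(h, k). a * h + b * k) (0, h))) (at w)"
    by (rule has_derivative_compose[where g = F and f = "\<lambda>s. (z, s)", OF _ F])
      (auto intro!: derivative_eq_intros)
  then have "((\<lambda>w. F (z, w)) has_field_derivative b) (at w)"
    by (simp add: has_field_derivative_def)
  then show ?thesis
    unfolding field_differentiable_def by blast
qed

text \<open>
  The partial derivatives are continuous by \<open>continuous_on_deriv_param\<close>, so partial
  differentiability implies total differentiability.
\<close>

lemma Osgood_entire:
  assumes cont: "continuous_on UNIV (\<lambda>(z, w). F z w)"
    and z: "\<And>w. (\<lambda>z. F z w) holomorphic_on UNIV" and w: "\<And>z. F z holomorphic_on UNIV"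
  shows "complex_differentiable2 (\<lambda>(z, w). F z w) p"
proof -
  obtain a b where p: "p = (a, b)"
    by (cases p)
  have cd: "continuous_on UNIV (\<lambda>(z, w). deriv (F z) w)"
    using continuous_on_deriv_param[of UNIV F] cont w by simp
  have "((\<lambda>(z, w). F z w) has_derivative
      (\<lambda>(h, k). deriv (\<lambda>z. F z b) a * h + blinfun_apply (blinfun_mult_right (deriv (F a) b)) k))
      (at (a, b) within UNIV \<times> UNIV)"
  proof (rule has_derivative_partialsI)
    show "((\<lambda>z. F z b) has_derivative (*) (deriv (\<lambda>z. F z b) a)) (at a within UNIV)"
      using holomorphic_derivI[OF z[of b], of a] by (simp add: has_field_derivative_def)
    show "(F x has_derivative blinfun_apply (blinfun_mult_right (deriv (F x) y))) (at y within UNIV)" for x y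
      using holomorphic_derivI[OF w[of x], of y] by (simp add: has_field_derivative_def)
    have "continuous_on UNIV (\<lambda>p. blinfun_mult_right (deriv (F (fst p)) (snd p)))"
      using cd[unfolded case_prod_unfold]
      by (intro bounded_linear.continuous_on[OF bounded_linear_blinfun_mult_right])
    then show "continuous (at (a, b) within UNIV \<times> UNIV) (\<lambda>(x, y). blinfun_mult_right (deriv (F x) y))"
      by (simp add: case_prod_unfold continuous_on_eq_continuous_at)
  qed auto
  then show ?thesis
    unfolding p complex_differentiable2_def by auto
qed

text \<open>
  For \<open>\<mu>\<close> near a given point one circle can be used in all the Cauchy integrals, so continuity and
  holomorphy in the parameter \<open>c\<close> pass through the integral sign.
\<close>

lemma complex_differentiable2_regular_part:
  assumes G: "continuous_on ((- {0}) \<times> UNIV) (\<lambda>(l, c). G l c)"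
    and hol1: "\<And>c. (\<lambda>l. G l c) holomorphic_on - {0}"
    and hol2: "\<And>l. l \<noteq> 0 \<Longrightarrow> G l holomorphic_on UNIV"
  shows "complex_differentiable2 (\<lambda>(\<mu>, c). regular_part (\<lambda>l. G l c) \<mu>) p"
proof (rule Osgood_entire)
  have cont: "continuous_on (sphere 0 R \<times> UNIV) (\<lambda>(l, c). G l c)" if "0 < R" for R
    using that by (intro continuous_on_subset[OF G]) auto
  have "isCont (\<lambda>(\<mu>, c). regular_part (\<lambda>l. G l c) \<mu>) q" for q
  proof -
    define R where "R = norm (fst q) + 1"
    have "0 < R"
      by (simp add: R_def add_nonneg_pos)
    let ?X = "ball 0 R \<times> (UNIV :: complex set)"
    have "continuous_on (?X \<times> sphere 0 R) (\<lambda>(p, l). G l (snd p) / (l - fst p))"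
      unfolding case_prod_unfold
      by (intro continuous_intros continuous_on_compose2[OF cont[OF \<open>0 < R\<close>, unfolded case_prod_unfold],
            of _ "\<lambda>q. (snd q, snd (fst q))", simplified]) auto
    then have "continuous_on ?X (\<lambda>p. contour_integral (circlepath 0 R) (\<lambda>l. G l (snd p) / (l - fst p)))"
      using \<open>0 < R\<close> by (intro continuous_on_contour_integral_circlepath) auto
    then have "continuous_on ?X (\<lambda>p. contour_integral (circlepath 0 R) (\<lambda>l. G l (snd p) / (l - fst p))
        / (2 * of_real pi * \<i>))"
      by (intro continuous_intros) auto
    then have "continuous_on ?X (\<lambda>(\<mu>, c). regular_part (\<lambda>l. G l c) \<mu>)"
      by (rule continuous_on_eq) (auto simp: regular_part_circle[OF hol1])
    then show ?thesis
      by (rule continuous_on_interior) (simp add: interior_Times R_def mem_Times_iff)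
  qed
  then show "continuous_on UNIV (\<lambda>(\<mu>, c). regular_part (\<lambda>l. G l c) \<mu>)"
    by (simp add: continuous_at_imp_continuous_on)
  show "(\<lambda>\<mu>. regular_part (\<lambda>l. G l c) \<mu>) holomorphic_on UNIV" for c
    by (rule holomorphic_regular_part[OF hol1])
  show "(\<lambda>c. regular_part (\<lambda>l. G l c) \<mu>) holomorphic_on UNIV" for \<mu>
  proof -
    define R where "R = norm \<mu> + 1"
    have "0 < R"
      by (simp add: R_def add_nonneg_pos)
    have "(\<lambda>c. contour_integral (circlepath 0 R) (\<lambda>l. G l c / (l - \<mu>))) holomorphic_on UNIV"
    proof (rule holomorphic_contour_integral_param)
      show "continuous_on (sphere 0 R \<times> UNIV) (\<lambda>(l, c). G l c / (l - \<mu>))"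
        using cont[OF \<open>0 < R\<close>] unfolding case_prod_unfold
        by (intro continuous_intros) (auto simp: R_def)
      show "(\<lambda>c. G l c / (l - \<mu>)) holomorphic_on UNIV" if "l \<in> sphere 0 R" for l
        using that \<open>0 < R\<close> by (intro holomorphic_intros hol2) (auto simp: R_def)
    qed (use \<open>0 < R\<close> in simp)
    then have "(\<lambda>c. contour_integral (circlepath 0 R) (\<lambda>l. G l c / (l - \<mu>)) / (2 * of_real pi * \<i>))
        holomorphic_on UNIV"
      by (intro holomorphic_intros) auto
    then show ?thesis
      by (simp only: regular_part_def R_def)
  qed
qed

lemma entire_polynomial_approximation:
  assumes "g holomorphic_on UNIV" "0 < (e::real)"
  obtains N a where "\<And>w. norm w \<le> M \<Longrightarrow> norm (g w - (\<Sum>n<N. a n * w ^ n)) < e"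
proof -
  define a where "a n = (deriv ^^ n) g 0 / fact n" for n
  have sums: "(\<lambda>n. a n * w ^ n) sums g w" for w
    using holomorphic_power_series[of g 0 "norm w + 1" w] assms(1)
    by (auto simp: a_def intro: holomorphic_on_subset)
  have "conv_radius a = \<infinity>"
    by (rule conv_radius_inftyI'') (use sums in \<open>auto simp: sums_iff\<close>)
  then have "uniform_limit (cball 0 M) (\<lambda>n w. \<Sum>i<n. a i * (w - 0) ^ i) (\<lambda>w. suminf (\<lambda>i. a i * (w - 0) ^ i)) sequentially"
    by (intro powser_uniform_limit) simp
  then have "uniform_limit (cball 0 M) (\<lambda>n w. \<Sum>i<n. a i * w ^ i) g sequentially"
    using sums by (simp add: sums_iff)
  from uniform_limitD[OF this assms(2)] obtain N
    where "\<forall>w\<in>cball 0 M. dist (\<Sum>i<N. a i * w ^ i) (g w) < e"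
    by (auto simp: eventually_sequentially)
  then show ?thesis
    by (intro that[of a N]) (auto simp: dist_norm norm_minus_commute)
qed

text \<open>
  The Cauchy kernel \<open>1 / (l - z)\<close> on the circle of radius \<open>M + 1\<close> is a geometric series in \<open>z\<close> that
  converges uniformly for \<open>norm z \<le> M\<close>. This approximates \<open>F\<close> by a polynomial in \<open>z\<close> whose
  coefficients \<open>g m\<close> are entire in \<open>w\<close>; replace each of them by a Taylor polynomial.
\<close>

lemma entire2_polynomial_approximation:
  assumes F: "\<And>p. complex_differentiable2 F p" and e: "0 < (e::real)" and "0 \<le> M"
  obtains I a where "finite I"
    "\<And>z w. norm z \<le> M \<Longrightarrow> norm w \<le> M \<Longrightarrow> norm (F (z, w) - (\<Sum>(m, n)\<in>I. a m n * z ^ m * w ^ n)) < e"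
proof -
  define R where "R = M + 1"
  have R: "0 < R" "M < R"
    using \<open>0 \<le> M\<close> by (auto simp: R_def)
  have cont: "continuous_on S F" for S
    using F complex_differentiable2_imp_continuous
    by (meson continuous_at_imp_continuous_on)
  have hol1: "(\<lambda>z. F (z, w)) holomorphic_on S" for w S
    using F complex_differentiable2_imp_fst
    by (meson field_differentiable_at_within holomorphic_on_def)
  have hol2: "(\<lambda>w. F (z, w)) holomorphic_on S" for z S
    using F complex_differentiable2_imp_snd
    by (meson field_differentiable_at_within holomorphic_on_def)
  have "bounded (F ` (sphere 0 R \<times> cball 0 M))"
    by (intro compact_imp_bounded compact_continuous_image cont compact_Times) auto
  then obtain B where B: "0 < B" "\<And>l w. norm l = R \<Longrightarrow> norm w \<le> M \<Longrightarrow> norm (F (l, w)) \<le> B"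
    unfolding bounded_pos by auto
  have "0 < e / (2 * B * R)" "M / R < 1"
    using e B R by auto
  then obtain N where N: "(M / R) ^ N < e / (2 * B * R)"
    using real_arch_pow_inv by blast
  define g where "g m w = contour_integral (circlepath 0 R) (\<lambda>l. F (l, w) / l ^ Suc m) / (2 * of_real pi * \<i>)" for m w
  have g: "g m holomorphic_on UNIV" for m
  proof -
    have "(\<lambda>w. contour_integral (circlepath 0 R) (\<lambda>l. F (l, w) / l ^ Suc m)) holomorphic_on UNIV"
    proof (rule holomorphic_contour_integral_param)
      show "continuous_on (sphere 0 R \<times> UNIV) (\<lambda>(l, c). F (l, c) / l ^ Suc m)"
        unfolding case_prod_unfold prod.collapse
        using R by (intro continuous_intros cont) auto
      show "(\<lambda>c. F (l, c) / l ^ Suc m) holomorphic_on UNIV" if "l \<in> sphere 0 R" for l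
        using that R by (intro holomorphic_intros hol2) auto
    qed (use R in simp)
    then show ?thesis
      unfolding g_def by (intro holomorphic_intros) auto
  qed
  have tail: "norm (F (z, w) - (\<Sum>m<N. z ^ m * g m w)) < e / 2" if z: "norm z \<le> M" and w: "norm w \<le> M" for z w
  proof -
    have ne: "l \<noteq> 0" "l \<noteq> z" if "norm l = R" for l
      using that z R by auto
    have contl: "continuous_on (sphere 0 R) (\<lambda>l. F (l, w))"
      by (intro holomorphic_on_imp_continuous_on hol1)
    have "((\<lambda>l. F (l, w) / (l - z)) has_contour_integral 2 * of_real pi * \<i> * F (z, w)) (circlepath 0 R)"
      by (rule Cauchy_integral_circlepath_simple[OF hol1]) (use z R in auto)
    moreover have "((\<lambda>l. F (l, w) / l ^ Suc m) has_contour_integral (2 * of_real pi * \<i> * g m w)) (circlepath 0 R)" for m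
    proof -
      have "2 * of_real pi * \<i> * g m w = contour_integral (circlepath 0 R) (\<lambda>l. F (l, w) / l ^ Suc m)"
        by (simp add: g_def)
      then show ?thesis
        using R ne by (simp only:, intro has_contour_integral_integral contour_integrable_continuous_circlepath
            continuous_intros) (auto intro!: contl)
    qed
    then have "((\<lambda>l. \<Sum>m<N. z ^ m * (F (l, w) / l ^ Suc m)) has_contour_integral
        (\<Sum>m<N. z ^ m * (2 * of_real pi * \<i> * g m w))) (circlepath 0 R)"
      by (intro has_contour_integral_sum has_contour_integral_lmul) auto
    ultimately have "((\<lambda>l. F (l, w) / (l - z) - (\<Sum>m<N. z ^ m * (F (l, w) / l ^ Suc m))) has_contour_integral
        (2 * of_real pi * \<i> * F (z, w) - (\<Sum>m<N. z ^ m * (2 * of_real pi * \<i> * g m w)))) (circlepath 0 R)"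
      by (rule has_contour_integral_diff)
    moreover have "2 * of_real pi * \<i> * F (z, w) - (\<Sum>m<N. z ^ m * (2 * of_real pi * \<i> * g m w)) =
        2 * of_real pi * \<i> * (F (z, w) - (\<Sum>m<N. z ^ m * g m w))"
      by (simp add: sum_distrib_left right_diff_distrib mult_ac)
    ultimately have int: "((\<lambda>l. F (l, w) / (l - z) - (\<Sum>m<N. z ^ m * (F (l, w) / l ^ Suc m))) has_contour_integral
        2 * of_real pi * \<i> * (F (z, w) - (\<Sum>m<N. z ^ m * g m w))) (circlepath 0 R)"
      by simp
    have "norm (2 * of_real pi * \<i> * (F (z, w) - (\<Sum>m<N. z ^ m * g m w))) \<le> (B * (M / R) ^ N) * (2 * pi * R)"
    proof (rule has_contour_integral_bound_circlepath[OF int])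
      fix l :: complex
      assume "norm (l - 0) = R"
      then have l: "norm l = R" by simp
      have geo: "1 / (l - z) - (\<Sum>m<N. z ^ m / l ^ Suc m) = (z / l) ^ N / (l - z)"
      proof (induction N)
        case (Suc N)
        have "1 / (l - z) - (\<Sum>m<Suc N. z ^ m / l ^ Suc m) = (z / l) ^ N / (l - z) - z ^ N / l ^ Suc N"
          using Suc by (simp add: algebra_simps)
        also have "\<dots> = (z / l) ^ N * (1 / (l - z) - 1 / l)"
          by (simp add: power_divide right_diff_distrib)
        also have "1 / (l - z) - 1 / l = (z / l) / (l - z)"
          using ne[OF l] by (simp add: divide_simps)
        also have "(z / l) ^ N * \<dots> = (z / l) ^ Suc N / (l - z)"
          by simp
        finally show ?case .
      qed simp
      have "F (l, w) / (l - z) - (\<Sum>m<N. z ^ m * (F (l, w) / l ^ Suc m)) = F (l, w) * ((z / l) ^ N / (l - z))"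
        unfolding geo[symmetric] by (simp add: right_diff_distrib sum_distrib_left mult_ac)
      also have "norm \<dots> \<le> B * ((M / R) ^ N / 1)"
        unfolding norm_mult norm_divide norm_power l
      proof (intro mult_mono frac_le power_mono)
        show "1 \<le> norm (l - z)"
          using norm_triangle_ineq2[of l z] l z by (simp add: R_def)
      qed (use B l w z R \<open>0 \<le> M\<close> in auto)
      finally show "norm (F (l, w) / (l - z) - (\<Sum>m<N. z ^ m * (F (l, w) / l ^ Suc m))) \<le> B * (M / R) ^ N"
        by simp
    qed (use B R \<open>0 \<le> M\<close> in auto)
    moreover have "norm (2 * of_real pi * \<i> * x) = (2 * pi) * norm x" for x
      by (simp add: norm_mult)
    ultimately have "(2 * pi) * norm (F (z, w) - (\<Sum>m<N. z ^ m * g m w)) \<le> (B * (M / R) ^ N) * (2 * pi * R)"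
      by metis
    also have "\<dots> = (2 * pi) * ((B * R) * (M / R) ^ N)"
      by (simp only: mult_ac)
    finally have "norm (F (z, w) - (\<Sum>m<N. z ^ m * g m w)) \<le> (B * R) * (M / R) ^ N"
      by (rule mult_left_le_imp_le) simp
    also have "\<dots> < (B * R) * (e / (2 * B * R))"
      using N B R by (intro mult_strict_left_mono) auto
    also have "\<dots> = e / 2"
      using B R by simp
    finally show ?thesis .
  qed
  define d where "d = e / (2 * (1 + (\<Sum>m<N. M ^ m)))"
  have s: "0 \<le> (\<Sum>m<N. M ^ m)"
    using \<open>0 \<le> M\<close> by (intro sum_nonneg) auto
  then have "0 < d"
    using e by (simp add: d_def)
  have "\<exists>K a. \<forall>w. norm w \<le> M \<longrightarrow> norm (g m w - (\<Sum>n<K. a n * w ^ n)) < d" for m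
    using entire_polynomial_approximation[OF g \<open>0 < d\<close>, of M m] by metis
  then obtain K a where a: "\<And>m w. norm w \<le> M \<Longrightarrow> norm (g m w - (\<Sum>n<K m. a m n * w ^ n)) < d"
    by metis
  show ?thesis
  proof (rule that[of "Sigma {..<N} (\<lambda>m. {..<K m})" a])
    fix z w :: complex
    assume z: "norm z \<le> M" and w: "norm w \<le> M"
    have "(\<Sum>(m, n)\<in>Sigma {..<N} (\<lambda>m. {..<K m}). a m n * z ^ m * w ^ n) =
        (\<Sum>m<N. z ^ m * (\<Sum>n<K m. a m n * w ^ n))"
      by (subst sum.Sigma[symmetric]) (auto simp: sum_distrib_left mult_ac)
    then have "F (z, w) - (\<Sum>(m, n)\<in>Sigma {..<N} (\<lambda>m. {..<K m}). a m n * z ^ m * w ^ n) =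
        (F (z, w) - (\<Sum>m<N. z ^ m * g m w)) + (\<Sum>m<N. z ^ m * (g m w - (\<Sum>n<K m. a m n * w ^ n)))"
      by (simp add: right_diff_distrib sum_subtractf)
    also have "norm \<dots> \<le> norm (F (z, w) - (\<Sum>m<N. z ^ m * g m w)) + (\<Sum>m<N. M ^ m * d)"
    proof (intro order_trans[OF norm_triangle_ineq] add_left_mono sum_norm_le)
      show "norm (z ^ m * (g m w - (\<Sum>n<K m. a m n * w ^ n))) \<le> M ^ m * d" for m
        unfolding norm_mult norm_power using z less_imp_le[OF a[OF w, of m]] \<open>0 \<le> M\<close>
        by (intro mult_mono power_mono) auto
    qed
    also have "(\<Sum>m<N. M ^ m * d) \<le> e / 2"
    proof -
      have "(\<Sum>m<N. M ^ m * d) = (\<Sum>m<N. M ^ m) * d"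
        by (simp add: sum_distrib_right)
      also have "\<dots> \<le> (1 + (\<Sum>m<N. M ^ m)) * d"
        using \<open>0 < d\<close> by (intro mult_right_mono) auto
      also have "\<dots> = e / 2"
      proof -
        have "x * (e / (2 * x)) = e / 2" if "x \<noteq> 0" for x :: real
          using that by simp
        then show ?thesis
          unfolding d_def using s by (metis add_nonneg_eq_0_iff zero_le_one zero_neq_one)
      qed
      finally show ?thesis .
    qed
    finally show "norm (F (z, w) - (\<Sum>(m, n)\<in>Sigma {..<N} (\<lambda>m. {..<K m}). a m n * z ^ m * w ^ n)) < e"
      using tail[OF z w] by simp
  qed auto
qed

section \<open>Charts and holomorphic functions on \<Omega>\<close>

lemma openin_sphere_topology:
  "openin sphere_topology V \<longleftrightarrow>
     (\<exists>U. open U \<and> V = Some ` U) \<or> (\<exists>C. compact C \<and> V = insert None (Some ` (- C)))"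
  unfolding sphere_topology_def openin_Alexandroff_compactification
  by (auto simp: Compl_eq_Diff_UNIV compact_imp_closed)

lemma continuous_map_chart_inf: "continuous_map euclidean sphere_topology chart_inf"
  unfolding continuous_map_def
proof (intro conjI allI impI)
  show "chart_inf \<in> topspace euclidean \<rightarrow> topspace sphere_topology"
    by (auto simp: sphere_topology_def chart_inf_def)
  fix V
  assume "openin sphere_topology V"
  have inv: "continuous_on (- {0}) (\<lambda>u::complex. 1 / u)"
    by (intro continuous_intros) auto
  from \<open>openin sphere_topology V\<close>
  consider U where "open U" "V = Some ` U" | C where "compact C" "V = insert None (Some ` (- C))"
    unfolding openin_sphere_topology by blast
  then show "openin euclidean {u \<in> topspace euclidean. chart_inf u \<in> V}"
  proof cases
    case 1
    have "{u. chart_inf u \<in> V} = - {0} \<inter> (\<lambda>u. 1 / u) -` U"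
      using 1 by (auto simp: chart_inf_def split: if_splits)
    then show ?thesis
      using continuous_open_preimage[OF inv _ \<open>open U\<close>] by auto
  next
    case 2
    obtain B where B: "0 < B" "\<And>z. z \<in> C \<Longrightarrow> norm z \<le> B"
      using compact_imp_bounded[OF \<open>compact C\<close>] unfolding bounded_pos by blast
    \<comment> \<open>The disc corresponds to a neighbourhood of infinity that avoids the bounded set \<open>C\<close>.\<close>
    have "{u. chart_inf u \<in> V} = (- {0} \<inter> (\<lambda>u. 1 / u) -` (- C)) \<union> ball 0 (1 / B)"
    proof -
      have "1 / u \<notin> C" if "u \<noteq> 0" "norm u < 1 / B" for u
        using B(1) B(2)[of "1 / u"] that by (auto simp: norm_divide field_simps)
      then show ?thesis
        using 2 B(1) by (auto simp: chart_inf_def split: if_splits)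
    qed
    moreover have "open (- {0} \<inter> (\<lambda>u::complex. 1 / u) -` (- C))"
      using \<open>compact C\<close> by (intro continuous_open_preimage[OF inv]) (auto intro: compact_imp_closed)
    ultimately show ?thesis
      by auto
  qed
qed

lemma open_map_chart_inf: "open_map euclidean sphere_topology chart_inf"
  unfolding open_map_def
proof (intro allI impI)
  fix U :: "complex set"
  assume "openin euclidean U"
  then have U: "open U" by simp
  have inv: "continuous_on (- {0}) (\<lambda>u::complex. 1 / u)"
    by (intro continuous_intros) auto
  show "openin sphere_topology (chart_inf ` U)"
  proof (cases "0 \<in> U")
    case False
    have "chart_inf ` U = Some ` (- {0} \<inter> (\<lambda>u. 1 / u) -` U)"
    proof -
      have "Some (1 / u) \<in> Some ` (- {0} \<inter> (\<lambda>u. 1 / u) -` U)" if "u \<in> U" for u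
        using that False by (intro imageI) auto
      moreover have "Some z \<in> chart_inf ` U" if "z \<noteq> 0" "1 / z \<in> U" for z
        using that by (intro image_eqI[of _ _ "1 / z"]) (auto simp: chart_inf_def)
      ultimately show ?thesis
        using False by (auto simp: chart_inf_def)
    qed
    then show ?thesis
      unfolding openin_sphere_topology using continuous_open_preimage[OF inv _ U] by blast
  next
    case True
    then obtain r where r: "0 < r" "ball 0 r \<subseteq> U"
      using U open_contains_ball by blast
    \<comment> \<open>The complement of the image in the finite plane; \<open>U\<close> contains a disc around \<open>0\<close>, so it is bounded.\<close>
    define C where "C = {z. z = 0 \<or> 1 / z \<notin> U}"
    have "- C = - {0} \<inter> (\<lambda>u. 1 / u) -` U"
      by (auto simp: C_def)
    then have "closed C"
      unfolding closed_def using continuous_open_preimage[OF inv _ U] open_Compl[OF closed_singleton[of "0::complex"]]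
      by metis
    moreover have "C \<subseteq> cball 0 (1 / r)"
    proof
      fix z assume "z \<in> C"
      then have "z = 0 \<or> 1 / z \<notin> ball 0 r"
        using r by (auto simp: C_def)
      then show "z \<in> cball 0 (1 / r)"
        using r by (cases "z = 0") (auto simp: norm_divide field_simps)
    qed
    ultimately have "compact C"
      by (metis bounded_cball bounded_subset compact_eq_bounded_closed)
    moreover have "chart_inf ` U = insert None (Some ` (- C))"
    proof -
      have "Some (1 / u) \<in> Some ` (- C)" if "u \<in> U" "u \<noteq> 0" for u
        using that by (intro imageI) (auto simp: C_def)
      moreover have "Some z \<in> chart_inf ` U" if "z \<notin> C" for z
        using that by (intro image_eqI[of _ _ "1 / z"]) (auto simp: chart_inf_def C_def)
      moreover have "None \<in> chart_inf ` U"
        using True by (auto simp: chart_inf_def image_iff)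
      ultimately show ?thesis
        by (auto simp: chart_inf_def)
    qed
    ultimately show ?thesis
      unfolding openin_sphere_topology by blast
  qed
qed

abbreviation charts :: "(complex \<Rightarrow> sphere) set" where
  "charts \<equiv> {Some, chart_inf}"

lemma open_map_chart: "\<phi> \<in> charts \<Longrightarrow> open_map euclidean sphere_topology \<phi>"
  using open_map_chart_inf open_map_Some[of euclidean] by (auto simp: sphere_topology_def)

lemma openin_chart_image:
  assumes "\<phi> \<in> charts" "\<psi> \<in> charts" "open S"
  shows "openin (prod_topology sphere_topology sphere_topology) (map_prod \<phi> \<psi> ` S)"
  unfolding openin_prod_topology_alt
proof (intro allI impI)
  fix x y
  assume "(x, y) \<in> map_prod \<phi> \<psi> ` S"
  then obtain u v where uv: "(u, v) \<in> S" "x = \<phi> u" "y = \<psi> v"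
    by auto
  obtain U V where "open U" "open V" "(u, v) \<in> U \<times> V" "U \<times> V \<subseteq> S"
    using open_prod_elim[OF \<open>open S\<close> uv(1)] by blast
  then show "\<exists>U V. openin sphere_topology U \<and> openin sphere_topology V \<and> x \<in> U \<and> y \<in> V \<and>
      U \<times> V \<subseteq> map_prod \<phi> \<psi> ` S"
    proof (intro exI conjI)
      show "openin sphere_topology (\<phi> ` U)" "openin sphere_topology (\<psi> ` V)"
        using open_map_chart[OF assms(1)] open_map_chart[OF assms(2)] \<open>open U\<close> \<open>open V\<close>
        by (simp_all add: open_map_def)
      show "\<phi> ` U \<times> \<psi> ` V \<subseteq> map_prod \<phi> \<psi> ` S"
        using \<open>U \<times> V \<subseteq> S\<close> by (auto intro!: image_eqI)
    qed (use \<open>(u, v) \<in> U \<times> V\<close> uv in auto)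
qed

lemma Omega_charts [simp]:
  "(Some z, Some w) \<in> Omega \<longleftrightarrow> z * w \<noteq> 1"
  "(chart_inf u, Some w) \<in> Omega \<longleftrightarrow> u \<noteq> w"
  "(Some z, chart_inf v) \<in> Omega \<longleftrightarrow> z \<noteq> v"
  "(chart_inf u, chart_inf v) \<in> Omega \<longleftrightarrow> u * v \<noteq> 1"
  by (auto simp: Omega_def chart_inf_def divide_eq_1_iff)

lemma chart_cases:
  obtains \<phi> u where "\<phi> \<in> charts" "x = \<phi> u"
proof (cases x)
  case None
  have "x = chart_inf 0"
    by (simp add: chart_inf_def None)
  then show thesis
    by (rule that[rotated]) simp
next
  case (Some z)
  then show thesis
    by (rule that[rotated]) simp
qed

lemma open_chart_domain:
  assumes "\<phi> \<in> charts" "\<psi> \<in> charts"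
  shows "open {p. map_prod \<phi> \<psi> p \<in> Omega}"
proof -
  have "open {p :: complex \<times> complex. fst p * snd p \<noteq> 1}" "open {p :: complex \<times> complex. fst p \<noteq> snd p}"
    by (intro open_Collect_neq continuous_intros)+
  then show ?thesis
    using assms by (auto simp: map_prod_def case_prod_unfold)
qed

lemma Hol_iff:
  "f \<in> Hol \<longleftrightarrow> (\<forall>x. x \<notin> Omega \<longrightarrow> f x = 0) \<and>
     (\<forall>\<phi>\<in>charts. \<forall>\<psi>\<in>charts. \<forall>p. map_prod \<phi> \<psi> p \<in> Omega \<longrightarrow>
        complex_differentiable2 (\<lambda>q. f (map_prod \<phi> \<psi> q)) p)"
  unfolding Hol_def holomorphic_on_sphere2_def complex_differentiable2_def
  by (auto simp: map_prod_def case_prod_unfold)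

lemma Hol_outside: "f \<in> Hol \<Longrightarrow> x \<notin> Omega \<Longrightarrow> f x = 0"
  unfolding Hol_iff by blast

lemma Hol_chart:
  "f \<in> Hol \<Longrightarrow> \<phi> \<in> charts \<Longrightarrow> \<psi> \<in> charts \<Longrightarrow> map_prod \<phi> \<psi> p \<in> Omega \<Longrightarrow>
     complex_differentiable2 (\<lambda>q. f (map_prod \<phi> \<psi> q)) p"
  unfolding Hol_iff by blast

lemma topspace_Omega_topology [simp]: "topspace Omega_topology = Omega"
  by (auto simp: Omega_topology_def sphere_topology_def image_iff)

lemma continuous_map_Hol:
  assumes "f \<in> Hol"
  shows "continuous_map Omega_topology euclidean f"
  unfolding continuous_map_def
proof (intro conjI allI impI)
  fix V :: "complex set"
  assume "openin euclidean V"
  then have V: "open V" by simp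
  define D :: "(complex \<Rightarrow> sphere) \<Rightarrow> (complex \<Rightarrow> sphere) \<Rightarrow> (complex \<times> complex) set"
    where "D \<phi> \<psi> = {p. map_prod \<phi> \<psi> p \<in> Omega} \<inter> (\<lambda>q. f (map_prod \<phi> \<psi> q)) -` V" for \<phi> \<psi>
  have D: "open (D \<phi> \<psi>)" if "\<phi> \<in> charts" "\<psi> \<in> charts" for \<phi> \<psi>
  proof -
    have "continuous_on {p. map_prod \<phi> \<psi> p \<in> Omega} (\<lambda>q. f (map_prod \<phi> \<psi> q))"
      using Hol_chart[OF assms that] complex_differentiable2_imp_continuous
      by (intro continuous_at_imp_continuous_on ballI) blast
    then show ?thesis
      unfolding D_def by (rule continuous_open_preimage[OF _ open_chart_domain[OF that] V])
  qed
  let ?W = "\<Union>c\<in>charts \<times> charts. map_prod (fst c) (snd c) ` D (fst c) (snd c)"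
  have W1: "openin (prod_topology sphere_topology sphere_topology) ?W"
  proof (rule openin_Union)
    fix S
    assume "S \<in> (\<lambda>c. map_prod (fst c) (snd c) ` D (fst c) (snd c)) ` (charts \<times> charts)"
    then obtain c where "c \<in> charts \<times> charts" and S: "S = map_prod (fst c) (snd c) ` D (fst c) (snd c)"
      by (rule imageE)
    then have "fst c \<in> charts" "snd c \<in> charts"
      by (simp_all only: mem_Times_iff)
    then show "openin (prod_topology sphere_topology sphere_topology) S"
      unfolding S by (intro openin_chart_image D)
  qed
  have W2: "{x \<in> Omega. f x \<in> V} = ?W \<inter> Omega"
  proof (intro set_eqI iffI)
    fix x assume x: "x \<in> {x \<in> Omega. f x \<in> V}"
    obtain \<phi> u where \<phi>: "\<phi> \<in> charts" "fst x = \<phi> u"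
      by (rule chart_cases)
    obtain \<psi> v where \<psi>: "\<psi> \<in> charts" "snd x = \<psi> v"
      by (rule chart_cases)
    have xeq: "x = map_prod \<phi> \<psi> (u, v)"
      using \<phi> \<psi> by (simp add: prod_eq_iff)
    have "(u, v) \<in> D \<phi> \<psi>"
      using x unfolding xeq D_def by simp
    then have "x \<in> map_prod \<phi> \<psi> ` D \<phi> \<psi>"
      unfolding xeq by (rule imageI)
    moreover have "(\<phi>, \<psi>) \<in> charts \<times> charts"
      using \<phi>(1) \<psi>(1) by blast
    ultimately have "x \<in> ?W"
      by (intro UN_I[of "(\<phi>, \<psi>)"]) simp_all
    then show "x \<in> ?W \<inter> Omega"
      using x by blast
  next
    fix x assume "x \<in> ?W \<inter> Omega"
    then have W: "x \<in> ?W" and "x \<in> Omega"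
      by (simp_all only: Int_iff)
    from W obtain c where "x \<in> map_prod (fst c) (snd c) ` D (fst c) (snd c)"
      by (rule UN_E)
    then obtain q where q: "x = map_prod (fst c) (snd c) q" "q \<in> D (fst c) (snd c)"
      by (rule imageE)
    from q(2) have "f x \<in> V"
      unfolding q(1) D_def by (rule IntD2[THEN vimageD])
    with \<open>x \<in> Omega\<close> show "x \<in> {x \<in> Omega. f x \<in> V}"
      by simp
  qed
  have "openin Omega_topology {x \<in> Omega. f x \<in> V}"
    unfolding Omega_topology_def openin_subtopology by (rule exI, rule conjI[OF W1 W2])
  then show "openin Omega_topology {x \<in> topspace Omega_topology. f x \<in> V}"
    by (simp only: topspace_Omega_topology)
qed simp

lemma compact_image_Hol:
  assumes "f \<in> Hol" "compactin Omega_topology K"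
  shows "compact (f ` K)"
  using image_compactin[OF assms(2) continuous_map_Hol[OF assms(1)]] by simp

lemma compactin_Omega_subset: "compactin Omega_topology K \<Longrightarrow> K \<subseteq> Omega"
  using compactin_subset_topspace by fastforce

text \<open>
  Each point of \<open>\<Omega>\<close> is a limit of points with finite nonzero coordinates: in any product chart, move
  along the diagonal direction.
\<close>

lemma Hol_eqI:
  assumes f: "f \<in> Hol" and g: "g \<in> Hol"
    and eq: "\<And>z w. z \<noteq> 0 \<Longrightarrow> w \<noteq> 0 \<Longrightarrow> z * w \<noteq> 1 \<Longrightarrow> f (Some z, Some w) = g (Some z, Some w)"
  shows "f = g"
proof
  fix x
  show "f x = g x"
  proof (cases "x \<in> Omega")
    case True
    obtain \<phi> u where \<phi>: "\<phi> \<in> charts" "fst x = \<phi> u"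
      by (rule chart_cases)
    obtain \<psi> v where \<psi>: "\<psi> \<in> charts" "snd x = \<psi> v"
      by (rule chart_cases)
    have x: "x = map_prod \<phi> \<psi> (u, v)"
      using \<phi> \<psi> by (simp add: prod_eq_iff)
    let ?c = "\<lambda>t. (u + t, v + t)"
    have lim: "((\<lambda>t. h (map_prod \<phi> \<psi> (?c t))) \<longlongrightarrow> h x) (at 0)" if "h \<in> Hol" for h
    proof -
      have "isCont (\<lambda>q. h (map_prod \<phi> \<psi> q)) (u, v)"
        by (intro complex_differentiable2_imp_continuous Hol_chart that \<phi>(1) \<psi>(1)) (use True x in auto)
      moreover have "(?c \<longlongrightarrow> (u, v)) (at 0)"
        by (intro tendsto_eq_intros) auto
      ultimately show ?thesis
        unfolding x by (rule isCont_tendsto_compose)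
    qed
    have finite_point: "\<exists>z. z \<noteq> 0 \<and> \<theta> s = Some z" if "\<theta> \<in> charts" "s \<noteq> 0" for \<theta> s
      using that by (auto simp: chart_inf_def)
    have "\<forall>\<^sub>F t in at 0. u + t \<noteq> 0 \<and> v + t \<noteq> 0"
    proof (rule eventually_conj)
      show "\<forall>\<^sub>F t in at 0. u + t \<noteq> 0" "\<forall>\<^sub>F t in at 0. v + t \<noteq> 0"
        using eventually_neq_at_within[of "-u" 0 UNIV] eventually_neq_at_within[of "-v" 0 UNIV]
        by (auto elim!: eventually_mono simp: add_eq_0_iff)
    qed
    then have "\<forall>\<^sub>F t in at 0. f (map_prod \<phi> \<psi> (?c t)) = g (map_prod \<phi> \<psi> (?c t))"
    proof (rule eventually_mono)
      fix t assume t: "u + t \<noteq> 0 \<and> v + t \<noteq> 0"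
      obtain z w where zw: "z \<noteq> 0" "w \<noteq> 0" "map_prod \<phi> \<psi> (?c t) = (Some z, Some w)"
        using finite_point[OF \<phi>(1), of "u + t"] finite_point[OF \<psi>(1), of "v + t"] t by auto
      show "f (map_prod \<phi> \<psi> (?c t)) = g (map_prod \<phi> \<psi> (?c t))"
        unfolding zw(3) using eq[OF zw(1,2)] Hol_outside[OF f] Hol_outside[OF g]
        by (cases "z * w = 1") auto
    qed
    then have "((\<lambda>t. f (map_prod \<phi> \<psi> (?c t))) \<longlongrightarrow> g x) (at 0)"
      using lim[OF g] by (rule tendsto_cong[THEN iffD2])
    then show ?thesis
      using lim[OF f] by (intro tendsto_unique[of "at (0::complex)"]) auto
  qed (simp add: Hol_outside[OF f] Hol_outside[OF g])
qed

section \<open>Coordinates and orbits\<close>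

text \<open>
  The function \<open>z / (1 - zw)\<close> with its holomorphic extension to the points at infinity. At finite points
  with \<open>zw = 1\<close>, division by zero makes the value \<open>0\<close>. The function \<open>w / (1 - zw)\<close> is obtained by
  exchanging the two arguments.
\<close>

fun coord_a :: "sphere \<times> sphere \<Rightarrow> complex" where
  "coord_a (Some z, Some w) = z / (1 - z * w)"
| "coord_a (None, Some w) = - 1 / w"
| "coord_a (_, None) = 0"

text \<open>
  The function \<open>zw / (1 - zw)\<close>, extended in the same way: its value at a point of \<open>\<Omega>\<close> at infinity is
  \<open>- 1\<close>.
\<close>

fun coord_c :: "sphere \<times> sphere \<Rightarrow> complex" where
  "coord_c (Some z, Some w) = z * w / (1 - z * w)"
| "coord_c (None, Some w) = (if w = 0 then 0 else - 1)"
| "coord_c (Some z, None) = (if z = 0 then 0 else - 1)"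
| "coord_c (None, None) = - 1"

lemma chart_inf_simps: "chart_inf 0 = None" "u \<noteq> 0 \<Longrightarrow> chart_inf u = Some (1 / u)"
  by (simp_all add: chart_inf_def)

text \<open>
  In each of the four product charts both coordinates are rational functions whose denominator vanishes
  exactly outside \<open>\<Omega>\<close>. The equations hold everywhere, since both sides are then \<open>0\<close>.
\<close>

lemma coord_charts:
  "coord_a (Some z, Some w) = z / (1 - z * w)"
  "coord_a (chart_inf u, Some w) = 1 / (u - w)"
  "coord_a (Some z, chart_inf v) = z * v / (v - z)"
  "coord_a (chart_inf u, chart_inf v) = v / (u * v - 1)"
  "coord_c (Some z, Some w) = z * w / (1 - z * w)"
  "coord_c (chart_inf u, Some w) = w / (u - w)"
  "coord_c (Some z, chart_inf v) = z / (v - z)"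
  "coord_c (chart_inf u, chart_inf v) = 1 / (u * v - 1)"
proof -
  have 1: "coord_a (chart_inf u, Some w) = 1 / (u - w) \<and> coord_c (chart_inf u, Some w) = w / (u - w)"
  proof (cases "u = 0")
    case False
    have "1 - (1 / u) * w = (u - w) / u"
      using False by (simp add: diff_divide_distrib)
    then have "coord_a (chart_inf u, Some w) = (1 / u) / ((u - w) / u)"
      "coord_c (chart_inf u, Some w) = ((1 / u) * w) / ((u - w) / u)"
      by (simp_all only: chart_inf_simps(2)[OF False] coord_a.simps coord_c.simps)
    moreover have "(1 / u) / ((u - w) / u) = 1 / (u - w)" "((1 / u) * w) / ((u - w) / u) = w / (u - w)"
      using False by simp_all
    ultimately show ?thesis
      by (simp only: simp_thms)
  qed (simp add: chart_inf_simps)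
  have 2: "coord_a (Some z, chart_inf v) = z * v / (v - z) \<and> coord_c (Some z, chart_inf v) = z / (v - z)"
  proof (cases "v = 0")
    case False
    have "1 - z * (1 / v) = (v - z) / v"
      using False by (simp add: diff_divide_distrib)
    then have "coord_a (Some z, chart_inf v) = z / ((v - z) / v)"
      "coord_c (Some z, chart_inf v) = (z * (1 / v)) / ((v - z) / v)"
      by (simp_all only: chart_inf_simps(2)[OF False] coord_a.simps coord_c.simps)
    moreover have "z / ((v - z) / v) = z * v / (v - z)" "(z * (1 / v)) / ((v - z) / v) = z / (v - z)"
      using False by simp_all
    ultimately show ?thesis
      by (simp only: simp_thms)
  qed (simp add: chart_inf_simps)
  have 3: "coord_a (chart_inf u, chart_inf v) = v / (u * v - 1) \<and>
    coord_c (chart_inf u, chart_inf v) = 1 / (u * v - 1)"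
  proof (cases "u = 0 \<or> v = 0")
    case False
    then have u: "u \<noteq> 0" and v: "v \<noteq> 0"
      by auto
    have "1 - (1 / u) * (1 / v) = (u * v - 1) / (u * v)"
      using u v by (simp add: diff_divide_distrib)
    then have "coord_a (chart_inf u, chart_inf v) = (1 / u) / ((u * v - 1) / (u * v))"
      "coord_c (chart_inf u, chart_inf v) = ((1 / u) * (1 / v)) / ((u * v - 1) / (u * v))"
      by (simp_all only: chart_inf_simps(2)[OF u] chart_inf_simps(2)[OF v] coord_a.simps coord_c.simps)
    moreover have "(1 / u) / ((u * v - 1) / (u * v)) = v / (u * v - 1)"
      "((1 / u) * (1 / v)) / ((u * v - 1) / (u * v)) = 1 / (u * v - 1)"
      using u v by simp_all
    ultimately show ?thesis
      by (simp only: simp_thms)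
  next
    case True
    then show ?thesis
      by (cases "u = 0"; cases "v = 0") (simp_all add: chart_inf_simps)
  qed
  show "coord_a (chart_inf u, Some w) = 1 / (u - w)" "coord_c (chart_inf u, Some w) = w / (u - w)"
    "coord_a (Some z, chart_inf v) = z * v / (v - z)" "coord_c (Some z, chart_inf v) = z / (v - z)"
    "coord_a (chart_inf u, chart_inf v) = v / (u * v - 1)"
    "coord_c (chart_inf u, chart_inf v) = 1 / (u * v - 1)"
    by (rule 1[THEN conjunct1] 1[THEN conjunct2] 2[THEN conjunct1] 2[THEN conjunct2]
        3[THEN conjunct1] 3[THEN conjunct2])+
qed simp_all

lemma coord_c_swap [simp]: "coord_c (prod.swap x) = coord_c x"
  by (cases x rule: coord_c.cases) (auto simp: mult.commute)

lemma Omega_swap [simp]: "prod.swap x \<in> Omega \<longleftrightarrow> x \<in> Omega"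
proof -
  have "sphere_mult (snd x) (fst x) = sphere_mult (fst x) (snd x)"
    by (cases "(fst x, snd x)" rule: sphere_mult.cases) (auto simp: mult.commute)
  then show ?thesis
    by (simp add: Omega_def prod.swap_def case_prod_unfold)
qed

lemma coord_differentiable:
  assumes "\<phi> \<in> charts" "\<psi> \<in> charts" "map_prod \<phi> \<psi> p \<in> Omega"
  shows "complex_differentiable2 (\<lambda>q. coord_a (map_prod \<phi> \<psi> q)) p"
    and "complex_differentiable2 (\<lambda>q. coord_c (map_prod \<phi> \<psi> q)) p"
proof -
  obtain u v where p: "p = (u, v)"
    by (cases p)
  have "complex_differentiable2 (\<lambda>q. coord_a (map_prod \<phi> \<psi> q)) p \<and>
      complex_differentiable2 (\<lambda>q. coord_c (map_prod \<phi> \<psi> q)) p"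
    using assms unfolding p
    by (elim insertE emptyE; simp add: map_prod_def case_prod_unfold coord_charts;
        intro conjI cd2_intros; simp)
  then show "complex_differentiable2 (\<lambda>q. coord_a (map_prod \<phi> \<psi> q)) p"
    and "complex_differentiable2 (\<lambda>q. coord_c (map_prod \<phi> \<psi> q)) p"
    by auto
qed

lemma complex_differentiable2_transform:
  assumes "complex_differentiable2 F p" "open D" "p \<in> D" "\<And>q. q \<in> D \<Longrightarrow> F q = G q"
  shows "complex_differentiable2 G p"
  using assms unfolding complex_differentiable2_def
  by (blast intro: has_derivative_transform_within_open)

definition on_Omega :: "(sphere \<times> sphere \<Rightarrow> complex) \<Rightarrow> sphere \<times> sphere \<Rightarrow> complex" where
  "on_Omega f x = (if x \<in> Omega then f x else 0)"

lemma on_Omega_in_Hol: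
  assumes "\<And>\<phi> \<psi> p. \<phi> \<in> charts \<Longrightarrow> \<psi> \<in> charts \<Longrightarrow> map_prod \<phi> \<psi> p \<in> Omega \<Longrightarrow>
    complex_differentiable2 (\<lambda>q. f (map_prod \<phi> \<psi> q)) p"
  shows "on_Omega f \<in> Hol"
  unfolding Hol_iff
proof (intro conjI ballI allI impI)
  fix \<phi> \<psi> p
  assume \<phi>: "\<phi> \<in> charts" and \<psi>: "\<psi> \<in> charts" and p: "map_prod \<phi> \<psi> p \<in> Omega"
  show "complex_differentiable2 (\<lambda>q. on_Omega f (map_prod \<phi> \<psi> q)) p"
    by (rule complex_differentiable2_transform[OF assms[OF \<phi> \<psi> p] open_chart_domain[OF \<phi> \<psi>]])
      (use p in \<open>simp_all add: on_Omega_def\<close>)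
qed (simp add: on_Omega_def)

lemma Hol_entire_in_coords:
  assumes "\<And>p. complex_differentiable2 F p"
  shows "on_Omega (\<lambda>x. F (coord_a x, coord_c x)) \<in> Hol"
  by (intro on_Omega_in_Hol complex_differentiable2_compose[OF assms] coord_differentiable)

lemma Hol_add: "f \<in> Hol \<Longrightarrow> g \<in> Hol \<Longrightarrow> f + g \<in> Hol"
  unfolding Hol_iff plus_fun_apply by (auto intro!: cd2_intros simp del: insert_iff)

lemma Hol_cmult: "f \<in> Hol \<Longrightarrow> (\<lambda>x. c * f x) \<in> Hol"
  unfolding Hol_iff by (auto intro!: cd2_intros simp del: insert_iff)

lemma Hol_diff: "f \<in> Hol \<Longrightarrow> g \<in> Hol \<Longrightarrow> f - g \<in> Hol"
  unfolding Hol_iff minus_apply by (auto intro!: cd2_intros simp del: insert_iff)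

lemma Hol_zero: "0 \<in> Hol"
  unfolding Hol_iff zero_fun_apply by (auto intro!: cd2_intros simp del: insert_iff)

lemma subspace_Hol: "cfun.subspace Hol"
  unfolding cfun.subspace_def by (blast intro: Hol_zero Hol_add Hol_cmult)

lemma Hol_swap:
  assumes "f \<in> Hol"
  shows "f \<circ> prod.swap \<in> Hol"
  unfolding Hol_iff
proof (intro conjI ballI allI impI)
  fix \<phi> \<psi> p
  assume \<phi>: "\<phi> \<in> charts" and \<psi>: "\<psi> \<in> charts" and p: "map_prod \<phi> \<psi> p \<in> Omega"
  have "complex_differentiable2 (\<lambda>q. f (map_prod \<psi> \<phi> q)) (snd p, fst p)"
    using p Omega_swap[of "map_prod \<phi> \<psi> p"]
    by (intro Hol_chart[OF assms \<psi> \<phi>]) (simp add: map_prod_def prod.swap_def case_prod_unfold)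
  from complex_differentiable2_compose[OF this complex_differentiable2_snd complex_differentiable2_fst]
  show "complex_differentiable2 (\<lambda>q. (f \<circ> prod.swap) (map_prod \<phi> \<psi> q)) p"
    by (simp add: map_prod_def prod.swap_def case_prod_unfold)
next
  fix x assume "x \<notin> Omega"
  then show "(f \<circ> prod.swap) x = 0"
    using Hol_outside[OF assms, of "prod.swap x"] by simp
qed

text \<open>
  Solving \<open>a = l\<close> and \<open>zw / (1 - zw) = c\<close> gives \<open>z = l / (1 + c)\<close> and \<open>w = c / l\<close>; the first of
  these is infinite for \<open>c = - 1\<close>, which is why it is written in the chart at infinity. For fixed \<open>c\<close>
  the image of \<open>l\<close> is an orbit of the action \<open>(z, w) \<mapsto> (\<lambda>z, w/\<lambda>)\<close>.
\<close>

definition orbit_map :: "complex \<Rightarrow> complex \<Rightarrow> sphere \<times> sphere" where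
  "orbit_map l c = (chart_inf ((1 + c) / l), Some (c / l))"

lemma orbit_map_props:
  assumes "l \<noteq> 0"
  shows "orbit_map l c \<in> Omega" "coord_a (orbit_map l c) = l" "coord_c (orbit_map l c) = c"
    "coord_a (prod.swap (orbit_map l c)) = c * (c + 1) / l"
proof -
  have *: "(1 + c) / l - c / l = 1 / l"
    by (simp add: diff_divide_distrib[symmetric])
  have "1 / l \<noteq> 0"
    using assms by simp
  then show "orbit_map l c \<in> Omega"
    using * by (auto simp: orbit_map_def)
  show "coord_a (orbit_map l c) = l" "coord_c (orbit_map l c) = c"
    using assms unfolding orbit_map_def coord_charts * by simp_all
  show "coord_a (prod.swap (orbit_map l c)) = c * (c + 1) / l"
    using assms unfolding orbit_map_def prod.swap_def fst_conv snd_conv coord_charts * by (simp add: add.commute)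
qed

lemma orbit_map_coords:
  assumes "z \<noteq> 0" "z * w \<noteq> 1"
  shows "orbit_map (coord_a (Some z, Some w)) (coord_c (Some z, Some w)) = (Some z, Some w)"
proof -
  have d: "1 - z * w \<noteq> 0"
    using assms(2) by simp
  then have "1 + z * w / (1 - z * w) = 1 / (1 - z * w)"
    by (simp add: field_simps)
  then show ?thesis
    using assms(1) d by (simp add: orbit_map_def chart_inf_def)
qed

text \<open>
  Since \<open>ab = c(c + 1)\<close>, exchanging the arguments, which exchanges \<open>a\<close> and \<open>b\<close>, inverts the orbit
  parameter up to the factor \<open>c(c + 1)\<close>.
\<close>

lemma orbit_map_swap:
  assumes "c \<noteq> 0" "c + 1 \<noteq> 0" "\<nu> \<noteq> 0"
  shows "prod.swap (orbit_map \<nu> c) = orbit_map (c * (c + 1) / \<nu>) c"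
proof -
  have "1 + c \<noteq> 0"
    using assms(2) by (simp add: add.commute)
  then show ?thesis
    using assms by (simp add: orbit_map_def chart_inf_def add.commute)
qed

lemma Hol_orbit_map:
  assumes "f \<in> Hol" "fst p \<noteq> 0"
  shows "complex_differentiable2 (\<lambda>(l, c). f (orbit_map l c)) p"
proof -
  have "map_prod chart_inf Some ((1 + snd p) / fst p, snd p / fst p) \<in> Omega"
    using orbit_map_props(1)[OF assms(2), of "snd p"] by (simp only: orbit_map_def map_prod_simp)
  then have "complex_differentiable2 (\<lambda>q. f (map_prod chart_inf Some q)) ((1 + snd p) / fst p, snd p / fst p)"
    by (intro Hol_chart[OF assms(1)]) simp_all
  moreover have "complex_differentiable2 (\<lambda>p. (1 + snd p) / fst p) p" "complex_differentiable2 (\<lambda>p. snd p / fst p) p"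
    by (intro cd2_intros complex_differentiable2_fst complex_differentiable2_snd assms(2))+
  ultimately have "complex_differentiable2
      (\<lambda>p. f (map_prod chart_inf Some ((1 + snd p) / fst p, snd p / fst p))) p"
    by (rule complex_differentiable2_compose[where F = "\<lambda>q. f (map_prod chart_inf Some q)"
        and g = "\<lambda>p. (1 + snd p) / fst p" and h = "\<lambda>p. snd p / fst p"])
  then show ?thesis
    by (simp add: orbit_map_def case_prod_unfold)
qed

lemma Hol_orbit_map_holomorphic:
  assumes "f \<in> Hol"
  shows "(\<lambda>l. f (orbit_map l c)) holomorphic_on - {0}"
    and "l \<noteq> 0 \<Longrightarrow> (\<lambda>c. f (orbit_map l c)) holomorphic_on UNIV"
    and "continuous_on ((- {0}) \<times> UNIV) (\<lambda>(l, c). f (orbit_map l c))"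
proof -
  have d: "complex_differentiable2 (\<lambda>(l, c). f (orbit_map l c)) (l, c)" if "l \<noteq> 0" for l c
    using Hol_orbit_map[OF assms, of "(l, c)"] that by simp
  have "(\<lambda>l. f (orbit_map l c)) field_differentiable at l" if "l \<noteq> 0" for l
    using complex_differentiable2_imp_fst[OF d[OF that]] by simp
  then show "(\<lambda>l. f (orbit_map l c)) holomorphic_on - {0}"
    by (simp add: holomorphic_on_def field_differentiable_at_within)
  have "(\<lambda>c. f (orbit_map l c)) field_differentiable at c" if "l \<noteq> 0" for c
    using complex_differentiable2_imp_snd[OF d[OF that]] by simp
  then show "(\<lambda>c. f (orbit_map l c)) holomorphic_on UNIV" if "l \<noteq> 0"
    using that by (simp add: holomorphic_on_def)
  have "isCont (\<lambda>(l, c). f (orbit_map l c)) p" if "p \<in> (- {0}) \<times> UNIV" for p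
  proof -
    have "fst p \<noteq> 0"
      using that by (simp add: mem_Times_iff)
    from complex_differentiable2_imp_continuous[OF d[OF this, of "snd p"]] show ?thesis
      by simp
  qed
  then show "continuous_on ((- {0}) \<times> UNIV) (\<lambda>(l, c). f (orbit_map l c))"
    by (intro continuous_at_imp_continuous_on ballI)
qed

lemma compactin_orbit_map:
  assumes "compact S" "0 \<notin> fst ` S"
  shows "compactin Omega_topology ((\<lambda>(l, c). orbit_map l c) ` S)"
proof (rule image_compactin)
  show "compactin (top_of_set S) S"
    using assms(1) by (simp add: compactin_subtopology)
  have c1: "continuous_on S (\<lambda>p. (1 + snd p) / fst p)" and c2: "continuous_on S (\<lambda>p. snd p / fst p)"
    using assms(2) by (intro continuous_intros; force)+
  have C1: "continuous_map (top_of_set S) sphere_topology (chart_inf \<circ> (\<lambda>p. (1 + snd p) / fst p))"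
    by (rule continuous_map_compose[OF _ continuous_map_chart_inf]) (use c1 in simp)
  have "continuous_map euclidean sphere_topology Some"
    unfolding sphere_topology_def by (rule continuous_map_Some)
  then have C2: "continuous_map (top_of_set S) sphere_topology (Some \<circ> (\<lambda>p. snd p / fst p))"
    by (rule continuous_map_compose[rotated]) (use c2 in simp)
  from C1 C2 have "continuous_map (top_of_set S) (prod_topology sphere_topology sphere_topology)
      (\<lambda>p. ((chart_inf \<circ> (\<lambda>p. (1 + snd p) / fst p)) p, (Some \<circ> (\<lambda>p. snd p / fst p)) p))"
    by (rule continuous_map_pairedI)
  moreover have "orbit_map (fst p) (snd p) \<in> Omega" if "p \<in> S" for p
    using that assms(2) by (intro orbit_map_props) force
  ultimately show "continuous_map (top_of_set S) Omega_topology (\<lambda>(l, c). orbit_map l c)"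
    unfolding Omega_topology_def continuous_map_in_subtopology
    by (simp add: orbit_map_def case_prod_unfold o_def)
qed

text \<open>
  These functions are the \<open>fpq p q\<close> with \<open>q \<le> p\<close>; with exchanged arguments and \<open>m > 0\<close> they are those
  with \<open>p < q\<close>. See \<open>fpq_past\<close> and \<open>fpq_future\<close>.
\<close>

definition coord_monomial :: "nat \<Rightarrow> nat \<Rightarrow> sphere \<times> sphere \<Rightarrow> complex" where
  "coord_monomial m n = on_Omega (\<lambda>x. coord_a x ^ m * coord_c x ^ n)"

lemma coord_monomial_Hol: "coord_monomial m n \<in> Hol"
proof -
  have "complex_differentiable2 (\<lambda>q. fst q ^ m * snd q ^ n) p" for p
    by (intro complex_differentiable2_mult complex_differentiable2_power
        complex_differentiable2_fst complex_differentiable2_snd)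
  from Hol_entire_in_coords[OF this] show ?thesis
    by (simp add: coord_monomial_def)
qed

lemma fpq_eqI:
  assumes "g \<in> Hol"
    and "\<And>z w. z * w \<noteq> 1 \<Longrightarrow> g (Some z, Some w) = z ^ p * w ^ q / (1 - z * w) ^ max p q"
  shows "fpq p q = g"
  unfolding fpq_def
proof (rule the_equality)
  fix f
  assume "f \<in> Hol \<and> (\<forall>z w. z * w \<noteq> 1 \<longrightarrow> f (Some z, Some w) = z ^ p * w ^ q / (1 - z * w) ^ max p q)"
  then show "f = g"
    using assms by (intro Hol_eqI) auto
qed (use assms in auto)

lemma coord_monomial_finite:
  assumes "z * w \<noteq> 1"
  shows "coord_monomial m n (Some z, Some w) = z ^ (m + n) * w ^ n / (1 - z * w) ^ (m + n)"
proof -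
  have "coord_monomial m n (Some z, Some w) = (z / (1 - z * w)) ^ m * (z * w / (1 - z * w)) ^ n"
    using assms by (simp add: coord_monomial_def on_Omega_def)
  also have "\<dots> = z ^ (m + n) * w ^ n / (1 - z * w) ^ (m + n)"
    unfolding power_divide power_mult_distrib power_add times_divide_times_eq by (simp only: mult.assoc)
  finally show ?thesis .
qed

lemma fpq_past: "fpq (m + n) n = coord_monomial m n"
  by (rule fpq_eqI[OF coord_monomial_Hol]) (simp add: coord_monomial_finite max_def)

lemma fpq_future: "fpq n (m + n) = coord_monomial m n \<circ> prod.swap"
proof (rule fpq_eqI[OF Hol_swap[OF coord_monomial_Hol]])
  fix z w :: complex
  assume "z * w \<noteq> 1"
  then have "w * z \<noteq> 1"
    by (metis mult.commute)
  then have "(coord_monomial m n \<circ> prod.swap) (Some z, Some w) =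
      w ^ (m + n) * z ^ n / (1 - w * z) ^ (m + n)"
    by (simp add: coord_monomial_finite)
  also have "\<dots> = z ^ n * w ^ (m + n) / (1 - z * w) ^ max n (m + n)"
    by (simp only: mult.commute max.absorb2 le_add2)
  finally show "(coord_monomial m n \<circ> prod.swap) (Some z, Some w) =
      z ^ n * w ^ (m + n) / (1 - z * w) ^ max n (m + n)" .
qed

section \<open>The compact-open topology\<close>

text \<open>
  The basic neighbourhoods for uniform convergence on compact sets. The next lemmas show that they are
  open and form a neighbourhood basis, so that the topology generated by the sets of functions that
  map a given compact set into a given open set is the topology of locally uniform convergence.
\<close>

definition hol_ball ::
  "(sphere \<times> sphere \<Rightarrow> complex) \<Rightarrow> (sphere \<times> sphere) set \<Rightarrow> real \<Rightarrow> (sphere \<times> sphere \<Rightarrow> complex) set" where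
  "hol_ball f K e = {g \<in> Hol. \<forall>x\<in>K. norm (g x - f x) < e}"

lemma openin_Hol_subbasic:
  assumes "compactin Omega_topology K" "open U"
  shows "openin Hol_topology {f \<in> Hol. f ` K \<subseteq> U}"
  unfolding Hol_topology_def using assms by (intro topology_generated_by_Basis) blast

text \<open>
  Around a member \<open>h\<close> of the ball, cover the compact set \<open>h ` K\<close> by finitely many small discs. The functions
  that map the part of \<open>K\<close> over each disc into a slightly larger disc form a finite intersection of
  subbasic sets, and they are uniformly close to \<open>h\<close> on \<open>K\<close>.
\<close>

lemma openin_hol_ball:
  assumes f: "f \<in> Hol" and K: "compactin Omega_topology K"
  shows "openin Hol_topology (hol_ball f K e)"
proof (subst openin_subopen, intro ballI)
  fix h
  assume h: "h \<in> hol_ball f K e"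
  then have "h \<in> Hol" and hf: "\<And>x. x \<in> K \<Longrightarrow> norm (h x - f x) < e"
    by (auto simp: hol_ball_def)
  obtain d where d: "0 < d" "\<And>x. x \<in> K \<Longrightarrow> norm (h x - f x) \<le> e - d"
  proof (cases "K = {}")
    case False
    have "compact ((\<lambda>z. norm z) ` (h - f) ` K)"
      by (intro compact_continuous_image compact_image_Hol Hol_diff \<open>h \<in> Hol\<close> f K continuous_intros)
    then obtain s where "s \<in> (\<lambda>z. norm z) ` (h - f) ` K" "\<And>t. t \<in> (\<lambda>z. norm z) ` (h - f) ` K \<Longrightarrow> t \<le> s"
      using compact_attains_sup[of "(\<lambda>z. norm z) ` (h - f) ` K"] False by auto
    then show thesis
      using hf by (intro that[of "e - s"]) auto
  qed (use that[of 1] in simp)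
  obtain Y where Y: "finite Y" "h ` K \<subseteq> (\<Union>y\<in>Y. ball y (d / 4))"
    using compact_image_Hol[OF \<open>h \<in> Hol\<close> K, unfolded compact_eq_totally_bounded] d(1)
    by (meson divide_pos_pos zero_less_numeral)
  define K' where "K' y = K \<inter> {x \<in> topspace Omega_topology. h x \<in> cball y (d / 4)}" for y
  have K': "compactin Omega_topology (K' y)" for y
    unfolding K'_def
    by (intro compact_Int_closedin[OF K] closedin_continuous_map_preimage[OF continuous_map_Hol[OF \<open>h \<in> Hol\<close>]])
      simp
  let ?T = "(\<Inter>y\<in>Y. {g \<in> Hol. g ` K' y \<subseteq> ball y (d / 2)}) \<inter> topspace Hol_topology"
  have "openin Hol_topology ?T"
    by (intro openin_INT Y(1) openin_Hol_subbasic K') simp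
  moreover have "h \<in> ?T"
    using \<open>h \<in> Hol\<close> d(1) by (auto simp: topspace_Hol_topology K'_def)
  moreover have "?T \<subseteq> hol_ball f K e"
  proof
    fix g assume g: "g \<in> ?T"
    have "norm (g x - f x) < e" if "x \<in> K" for x
    proof -
      have "h x \<in> (\<Union>y\<in>Y. ball y (d / 4))"
        using Y(2) that by blast
      then obtain y where "y \<in> Y" "dist y (h x) < d / 4"
        by auto
      moreover from this have "x \<in> K' y"
        using that compactin_Omega_subset[OF K] by (auto simp: K'_def)
      moreover have "g ` K' y \<subseteq> ball y (d / 2)"
        using g \<open>y \<in> Y\<close> by blast
      ultimately have "dist y (g x) < d / 2"
        by (auto simp: image_subset_iff simp del: less_divide_eq_numeral1)
      then have "dist (g x) (h x) < d"
        using \<open>dist y (h x) < d / 4\<close> dist_triangle3[of "g x" "h x" y] d(1) by linarith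
      then show ?thesis
        using d(2)[OF that] norm_triangle_ineq[of "g x - h x" "h x - f x"] by (simp add: dist_norm)
    qed
    then show "g \<in> hol_ball f K e"
      using g by (simp add: hol_ball_def topspace_Hol_topology)
  qed
  ultimately show "\<exists>T. openin Hol_topology T \<and> h \<in> T \<and> T \<subseteq> hol_ball f K e"
    by blast
qed

lemma hol_ball_mono: "K \<subseteq> K' \<Longrightarrow> e' \<le> e \<Longrightarrow> hol_ball f K' e' \<subseteq> hol_ball f K e"
  by (fastforce simp: hol_ball_def)

text \<open>
  For a subbasic set, the compact image \<open>f ` K\<close> has positive distance to the complement of \<open>U\<close>. The
  property passes to finite intersections by uniting the compact sets.
\<close>

lemma openin_Hol_contains_ball:
  assumes "openin Hol_topology S" "f \<in> S"
  obtains K e where "compactin Omega_topology K" "0 < e" "hol_ball f K e \<subseteq> S"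
proof -
  have "generate_topology_on {{f \<in> Hol. f ` K \<subseteq> U} | K U. compactin Omega_topology K \<and> open U} S"
    using assms(1) by (simp add: Hol_topology_def openin_topology_generated_by_iff)
  then have "\<forall>f\<in>S. \<exists>K e. compactin Omega_topology K \<and> 0 < e \<and> hol_ball f K e \<subseteq> S"
  proof induction
    case (Int a b)
    show ?case
    proof
      fix f assume "f \<in> a \<inter> b"
      then obtain K e K' e' where
        "compactin Omega_topology K" "0 < e" "hol_ball f K e \<subseteq> a"
        "compactin Omega_topology K'" "0 < e'" "hol_ball f K' e' \<subseteq> b"
        using Int.IH by blast
      then show "\<exists>K e. compactin Omega_topology K \<and> 0 < e \<and> hol_ball f K e \<subseteq> a \<inter> b"
        using hol_ball_mono[of K "K \<union> K'" "min e e'" e f] hol_ball_mono[of K' "K \<union> K'" "min e e'" e' f]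
        by (intro exI[of _ "K \<union> K'"] exI[of _ "min e e'"]) (auto intro: compactin_Un)
    qed
  next
    case (UN \<K>)
    then show ?case
      by (meson Union_iff Union_upper order_trans)
  next
    case (Basis s)
    then obtain K U where s: "s = {f \<in> Hol. f ` K \<subseteq> U}" and K: "compactin Omega_topology K" and "open U"
      by blast
    show ?case
    proof
      fix f assume f: "f \<in> s"
      then have "compact (f ` K)" "f ` K \<subseteq> U"
        using compact_image_Hol[OF _ K] by (auto simp: s)
      then obtain e where e: "0 < e" "(\<Union>x\<in>f ` K. ball x e) \<subseteq> U"
        using compact_subset_open_imp_ball_epsilon_subset[OF _ \<open>open U\<close>] by metis
      have "hol_ball f K e \<subseteq> s"
      proof
        fix g assume g: "g \<in> hol_ball f K e"
        have "g x \<in> U" if "x \<in> K" for x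
        proof -
          have "g x \<in> ball (f x) e"
            using g that by (simp add: hol_ball_def dist_norm norm_minus_commute)
          then show ?thesis
            using e(2) that by blast
        qed
        then show "g \<in> s"
          using g by (auto simp: s hol_ball_def)
      qed
      then show "\<exists>K e. compactin Omega_topology K \<and> 0 < e \<and> hol_ball f K e \<subseteq> s"
        using K e(1) by blast
    qed
  qed simp
  then show ?thesis
    using assms(2) that by blast
qed

lemma in_hol_ball_self: "f \<in> Hol \<Longrightarrow> 0 < e \<Longrightarrow> f \<in> hol_ball f K e"
  by (simp add: hol_ball_def)

lemma in_closure_of_Hol:
  assumes "S \<subseteq> Hol"
  shows "f \<in> Hol_topology closure_of S \<longleftrightarrow>
    f \<in> Hol \<and> (\<forall>K e. compactin Omega_topology K \<longrightarrow> 0 < e \<longrightarrow> (\<exists>g\<in>S. \<forall>x\<in>K. norm (g x - f x) < e))"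
proof (intro iffI conjI allI impI)
  assume f: "f \<in> Hol_topology closure_of S"
  then show "f \<in> Hol"
    using closure_of_subset_topspace[of Hol_topology S] topspace_Hol_topology by blast
  fix K and e :: real
  assume "compactin Omega_topology K" "0 < e"
  then have "\<exists>g. g \<in> S \<and> g \<in> hol_ball f K e"
    using f openin_hol_ball[OF \<open>f \<in> Hol\<close>, of K e] in_hol_ball_self[OF \<open>f \<in> Hol\<close>, of e K]
    unfolding in_closure_of by blast
  then show "\<exists>g\<in>S. \<forall>x\<in>K. norm (g x - f x) < e"
    by (auto simp: hol_ball_def)
next
  assume f: "f \<in> Hol \<and> (\<forall>K e. compactin Omega_topology K \<longrightarrow> 0 < e \<longrightarrow> (\<exists>g\<in>S. \<forall>x\<in>K. norm (g x - f x) < e))"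
  show "f \<in> Hol_topology closure_of S"
    unfolding in_closure_of topspace_Hol_topology
  proof (intro conjI allI impI)
    fix T assume "f \<in> T \<and> openin Hol_topology T"
    then have "f \<in> T" and T: "openin Hol_topology T"
      by auto
    from \<open>f \<in> T\<close> obtain K e where K: "compactin Omega_topology K" "0 < e" and sub: "hol_ball f K e \<subseteq> T"
      by (rule openin_Hol_contains_ball[OF T])
    from f K obtain g where "g \<in> S" "\<forall>x\<in>K. norm (g x - f x) < e"
      by blast
    then have "g \<in> S \<and> g \<in> T"
      using assms sub by (auto simp: hol_ball_def)
    then show "\<exists>y. y \<in> S \<and> y \<in> T"
      by blast
  qed (use f in blast)
qed

lemma continuous_map_into_Hol_topology:
  assumes F: "\<And>a. a \<in> topspace X \<Longrightarrow> F a \<in> Hol"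
    and near: "\<And>a K e. a \<in> topspace X \<Longrightarrow> compactin Omega_topology K \<Longrightarrow> 0 < e \<Longrightarrow>
      \<exists>U. openin X U \<and> a \<in> U \<and> (\<forall>b\<in>U. \<forall>x\<in>K. norm (F b x - F a x) < e)"
  shows "continuous_map X Hol_topology F"
  unfolding continuous_map_def
proof (intro conjI allI impI)
  show "F \<in> topspace X \<rightarrow> topspace Hol_topology"
    using F by (simp add: topspace_Hol_topology)
  fix S assume S: "openin Hol_topology S"
  show "openin X {a \<in> topspace X. F a \<in> S}"
  proof (subst openin_subopen, intro ballI)
    fix a assume "a \<in> {a \<in> topspace X. F a \<in> S}"
    then have a: "a \<in> topspace X" "F a \<in> S"
      by auto
    from a(2) obtain K e where K: "compactin Omega_topology K" "0 < e" "hol_ball (F a) K e \<subseteq> S"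
      by (rule openin_Hol_contains_ball[OF S])
    from near[OF a(1) K(1,2)]
    obtain U where U: "openin X U" "a \<in> U" "\<forall>b\<in>U. \<forall>x\<in>K. norm (F b x - F a x) < e"
      by blast
    have "U \<subseteq> {a \<in> topspace X. F a \<in> S}"
    proof
      fix b assume "b \<in> U"
      then have "b \<in> topspace X"
        using openin_subset[OF U(1)] by blast
      moreover from this have "F b \<in> hol_ball (F a) K e"
        using U(3) F \<open>b \<in> U\<close> by (simp add: hol_ball_def)
      ultimately show "b \<in> {a \<in> topspace X. F a \<in> S}"
        using K(3) by blast
    qed
    then show "\<exists>T. openin X T \<and> a \<in> T \<and> T \<subseteq> {a \<in> topspace X. F a \<in> S}"
      using U by blast
  qed
qed

lemma continuous_map_Hol_add:
  assumes "A \<subseteq> Hol" "B \<subseteq> Hol"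
  shows "continuous_map (prod_topology (subtopology Hol_topology A) (subtopology Hol_topology B)) Hol_topology
    (\<lambda>(f, g). f + g)"
proof (rule continuous_map_into_Hol_topology)
  fix p assume "p \<in> topspace (prod_topology (subtopology Hol_topology A) (subtopology Hol_topology B))"
  then have p: "fst p \<in> A" "snd p \<in> B" "fst p \<in> Hol" "snd p \<in> Hol"
    by (auto simp: topspace_Hol_topology)
  then show "(\<lambda>(f, g). f + g) p \<in> Hol"
    by (simp add: case_prod_unfold Hol_add)
  fix K and e :: real
  assume K: "compactin Omega_topology K" and "0 < e"
  let ?U = "(hol_ball (fst p) K (e / 2) \<inter> A) \<times> (hol_ball (snd p) K (e / 2) \<inter> B)"
  have "openin (prod_topology (subtopology Hol_topology A) (subtopology Hol_topology B)) ?U"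
    using openin_hol_ball[OF p(3) K] openin_hol_ball[OF p(4) K]
    by (auto simp: openin_prod_Times_iff intro: openin_subtopology_Int)
  moreover have "p \<in> ?U"
    using p \<open>0 < e\<close> in_hol_ball_self[of _ "e / 2" K] by (simp add: mem_Times_iff)
  moreover have "norm ((\<lambda>(f, g). f + g) q x - (\<lambda>(f, g). f + g) p x) < e" if "q \<in> ?U" "x \<in> K" for q x
  proof -
    have "norm (fst q x - fst p x) < e / 2" "norm (snd q x - snd p x) < e / 2"
      using that by (auto simp: hol_ball_def mem_Times_iff)
    moreover have "(\<lambda>(f, g). f + g) q x - (\<lambda>(f, g). f + g) p x = (fst q x - fst p x) + (snd q x - snd p x)"
      by (simp add: case_prod_unfold)
    ultimately show ?thesis
      using norm_triangle_ineq[of "fst q x - fst p x" "snd q x - snd p x"] by simp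
  qed
  ultimately show "\<exists>U. openin (prod_topology (subtopology Hol_topology A) (subtopology Hol_topology B)) U \<and>
      p \<in> U \<and> (\<forall>b\<in>U. \<forall>x\<in>K. norm ((\<lambda>(f, g). f + g) b x - (\<lambda>(f, g). f + g) p x) < e)"
    by blast
qed

section \<open>The projection onto the past\<close>

definition past_entire :: "(sphere \<times> sphere \<Rightarrow> complex) \<Rightarrow> complex \<times> complex \<Rightarrow> complex" where
  "past_entire f = (\<lambda>(\<mu>, c). regular_part (\<lambda>l. f (orbit_map l c)) \<mu>)"

definition past_part :: "(sphere \<times> sphere \<Rightarrow> complex) \<Rightarrow> sphere \<times> sphere \<Rightarrow> complex" where
  "past_part f = on_Omega (\<lambda>x. past_entire f (coord_a x, coord_c x))"

lemma complex_differentiable2_past_entire: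
  "f \<in> Hol \<Longrightarrow> complex_differentiable2 (past_entire f) p"
  unfolding past_entire_def
  by (rule complex_differentiable2_regular_part) (simp_all add: Hol_orbit_map_holomorphic)

lemma past_part_Hol: "f \<in> Hol \<Longrightarrow> past_part f \<in> Hol"
  unfolding past_part_def by (intro Hol_entire_in_coords complex_differentiable2_past_entire)

lemma past_part_add: "f \<in> Hol \<Longrightarrow> g \<in> Hol \<Longrightarrow> past_part (f + g) = past_part f + past_part g"
  by (auto simp: past_part_def past_entire_def on_Omega_def fun_eq_iff
      regular_part_add Hol_orbit_map_holomorphic(1))

lemma past_part_cmult: "f \<in> Hol \<Longrightarrow> past_part (\<lambda>x. r * f x) = (\<lambda>x. r * past_part f x)"
  by (auto simp: past_part_def past_entire_def on_Omega_def fun_eq_iff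
      regular_part_cmult Hol_orbit_map_holomorphic(1))

lemma past_part_diff:
  assumes "f \<in> Hol" "g \<in> Hol"
  shows "past_part (f - g) = past_part f - past_part g"
proof -
  have "past_part ((f - g) + g) = past_part (f - g) + past_part g"
    by (intro past_part_add Hol_diff assms)
  then show ?thesis
    by (simp add: algebra_simps)
qed

lemma on_Omega_swap: "on_Omega g \<circ> prod.swap = on_Omega (\<lambda>x. g (prod.swap x))"
  by (rule ext) (simp add: on_Omega_def)

lemma coords_bounded:
  assumes K: "compactin Omega_topology K"
  obtains M where "0 \<le> M" "\<And>x. x \<in> K \<Longrightarrow> norm (coord_a x) \<le> M" "\<And>x. x \<in> K \<Longrightarrow> norm (coord_c x) \<le> M"
    "\<And>x. x \<in> K \<Longrightarrow> norm (coord_a (prod.swap x)) \<le> M"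
proof -
  have bound: "\<exists>B. \<forall>x\<in>K. norm (g x) \<le> B" if "on_Omega g \<in> Hol" for g
  proof -
    have "bounded (on_Omega g ` K)"
      by (rule compact_imp_bounded[OF compact_image_Hol[OF that K]])
    moreover have "on_Omega g x = g x" if "x \<in> K" for x
      using that compactin_Omega_subset[OF K] by (auto simp: on_Omega_def)
    ultimately show ?thesis
      unfolding bounded_iff by auto
  qed
  have a: "on_Omega coord_a \<in> Hol" and c: "on_Omega coord_c \<in> Hol"
    using Hol_entire_in_coords[of fst] Hol_entire_in_coords[of snd]
    by (simp_all add: complex_differentiable2_fst complex_differentiable2_snd)
  have b: "on_Omega (\<lambda>x. coord_a (prod.swap x)) \<in> Hol"
    using Hol_swap[OF a] by (simp only: on_Omega_swap)
  obtain A B C where "\<forall>x\<in>K. norm (coord_a x) \<le> A" "\<forall>x\<in>K. norm (coord_c x) \<le> C"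
    "\<forall>x\<in>K. norm (coord_a (prod.swap x)) \<le> B"
    using bound[OF a] bound[OF b] bound[OF c] by blast
  then show ?thesis
    by (intro that[of "max 0 (max A (max B C))"]) (auto simp: le_max_iff_disj)
qed

text \<open>
  All the Cauchy integrals for points of \<open>K\<close> can be taken over one circle, of radius \<open>M + 1\<close> when \<open>M\<close>
  bounds the coordinates on \<open>K\<close>; so they see \<open>f\<close> only on the image under \<open>orbit_map\<close> of a compact set.
\<close>

lemma past_part_bound:
  assumes K: "compactin Omega_topology K"
  obtains K' C where "compactin Omega_topology K'" "0 < C"
    "\<And>f B x. f \<in> Hol \<Longrightarrow> (\<And>y. y \<in> K' \<Longrightarrow> norm (f y) \<le> B) \<Longrightarrow> x \<in> K \<Longrightarrow> norm (past_part f x) \<le> C * B"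
proof -
  obtain M where M: "0 \<le> M" "\<And>x. x \<in> K \<Longrightarrow> norm (coord_a x) \<le> M" "\<And>x. x \<in> K \<Longrightarrow> norm (coord_c x) \<le> M"
    using coords_bounded[OF K] by metis
  let ?K = "(\<lambda>(l, c). orbit_map l c) ` (sphere 0 (M + 1) \<times> cball 0 M)"
  show ?thesis
  proof (rule that)
    show "compactin Omega_topology ?K"
      using M(1) by (intro compactin_orbit_map compact_Times) auto
    show "0 < M + 1"
      using M(1) by simp
    fix f B x
    assume f: "f \<in> Hol" and B: "\<And>y. y \<in> ?K \<Longrightarrow> norm (f y) \<le> B" and x: "x \<in> K"
    have "norm (regular_part (\<lambda>l. f (orbit_map l (coord_c x))) (coord_a x)) \<le> (M + 1) * B"
    proof (rule regular_part_bound[OF Hol_orbit_map_holomorphic(1)[OF f]])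
      show "norm (coord_a x) + 1 \<le> M + 1"
        using M(2)[OF x] by simp
      show "norm (f (orbit_map l (coord_c x))) \<le> B" if "norm l = M + 1" for l
        using that M(3)[OF x] by (intro B) auto
    qed
    then show "norm (past_part f x) \<le> (M + 1) * B"
      using x compactin_Omega_subset[OF K] by (auto simp: past_part_def past_entire_def on_Omega_def)
  qed
qed

lemma continuous_map_past_part: "continuous_map Hol_topology Hol_topology past_part"
proof (rule continuous_map_into_Hol_topology)
  fix f K and e :: real
  assume "f \<in> topspace Hol_topology"
  then have f: "f \<in> Hol"
    by (simp add: topspace_Hol_topology)
  assume K: "compactin Omega_topology K" and "0 < e"
  obtain K' C where K': "compactin Omega_topology K'" and "0 < C" and
    bound: "\<And>f B x. f \<in> Hol \<Longrightarrow> (\<And>y. y \<in> K' \<Longrightarrow> norm (f y) \<le> B) \<Longrightarrow> x \<in> K \<Longrightarrow> norm (past_part f x) \<le> C * B"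
    using past_part_bound[OF K] by metis
  have e': "0 < e / (2 * C)"
    using \<open>0 < e\<close> \<open>0 < C\<close> by simp
  have "norm (past_part g x - past_part f x) < e" if g: "g \<in> hol_ball f K' (e / (2 * C))" and "x \<in> K" for g x
  proof -
    have "g \<in> Hol"
      using g by (simp add: hol_ball_def)
    have "norm (past_part (g - f) x) \<le> C * (e / (2 * C))"
      by (rule bound[OF Hol_diff[OF \<open>g \<in> Hol\<close> f] _ \<open>x \<in> K\<close>])
        (use g in \<open>auto simp: hol_ball_def intro: less_imp_le\<close>)
    also have "\<dots> < e"
      using \<open>0 < e\<close> \<open>0 < C\<close> by simp
    finally show ?thesis
      by (simp add: past_part_diff[OF \<open>g \<in> Hol\<close> f])
  qed
  then show "\<exists>U. openin Hol_topology U \<and> f \<in> U \<and> (\<forall>g\<in>U. \<forall>x\<in>K. norm (past_part g x - past_part f x) < e)"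
    using openin_hol_ball[OF f K', of "e / (2 * C)"] in_hol_ball_self[OF f e', of K'] by blast
qed (simp add: topspace_Hol_topology past_part_Hol)

text \<open>
  The identity \<open>past_part g = r g\<close> passes to locally uniform limits, because both sides at a point are
  controlled by the values of \<open>g\<close> on a compact set. It is used with \<open>r = 1\<close> for the past and \<open>r = 0\<close>
  for the future.
\<close>

lemma past_part_closure:
  assumes S: "S \<subseteq> Hol" "\<And>g. g \<in> S \<Longrightarrow> past_part g = (\<lambda>x. r * g x)"
    and f: "f \<in> Hol_topology closure_of S"
  shows "past_part f = (\<lambda>x. r * f x)"
proof
  fix x
  have fH: "f \<in> Hol"
    using f in_closure_of_Hol[OF S(1)] by blast
  show "past_part f x = r * f x"
  proof (cases "x \<in> Omega")
    case False
    then show ?thesis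
      using Hol_outside[OF fH] Hol_outside[OF past_part_Hol[OF fH]] by simp
  next
    case True
    then have K: "compactin Omega_topology {x}"
      by simp
    obtain K' C where K': "compactin Omega_topology K'" and "0 < C" and
      bound: "\<And>f B y. f \<in> Hol \<Longrightarrow> (\<And>y. y \<in> K' \<Longrightarrow> norm (f y) \<le> B) \<Longrightarrow> y \<in> {x} \<Longrightarrow> norm (past_part f y) \<le> C * B"
      using past_part_bound[OF K] by metis
    have "norm (past_part f x - r * f x) \<le> e" if "0 < e" for e
    proof -
      define d where "d = e / (C + norm r)"
      have Cr: "0 < C + norm r"
        using \<open>0 < C\<close> by (simp add: add_pos_nonneg)
      have "0 < d"
        using \<open>0 < e\<close> Cr by (simp add: d_def)
      obtain g where g: "g \<in> S" "\<And>y. y \<in> K' \<union> {x} \<Longrightarrow> norm (g y - f y) < d"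
        using f \<open>0 < d\<close> compactin_Un[OF K' K] unfolding in_closure_of_Hol[OF S(1)] by metis
      have gH: "g \<in> Hol"
        using g S by blast
      have 1: "norm (past_part (g - f) x) \<le> C * d"
        by (rule bound[OF Hol_diff[OF gH fH]]) (use g in \<open>auto intro: less_imp_le\<close>)
      have 2: "norm (r * (g x - f x)) \<le> norm r * d"
        using g(2)[of x] by (simp add: norm_mult mult_left_mono less_imp_le)
      have "past_part f x - r * f x = r * (g x - f x) - past_part (g - f) x"
        using S(2)[OF g(1)] by (simp add: past_part_diff[OF gH fH] algebra_simps)
      also have "norm \<dots> \<le> norm r * d + C * d"
        using norm_triangle_ineq4[of "r * (g x - f x)" "past_part (g - f) x"] 1 2 by linarith
      also have "\<dots> = (C + norm r) * d"
        by (simp add: algebra_simps)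
      also have "\<dots> = e"
        using Cr by (simp add: d_def)
      finally show ?thesis .
    qed
    then have "norm (past_part f x - r * f x) \<le> 0"
      using field_le_epsilon[of "norm (past_part f x - r * f x)" 0] by simp
    then show ?thesis
      by simp
  qed
qed

text \<open>
  On an orbit the function is \<open>l\<^sup>m c\<^sup>n\<close>, which is its own regular part.
\<close>

lemma past_part_coord_monomial: "past_part (coord_monomial m n) = coord_monomial m n"
proof -
  have "regular_part (\<lambda>l. coord_monomial m n (orbit_map l c)) \<mu> = \<mu> ^ m * c ^ n" for \<mu> c
  proof (rule regular_part_unique[where r = "\<lambda>_. 0"])
    show "coord_monomial m n (orbit_map l c) = l ^ m * c ^ n + 0" if "l \<noteq> 0" for l
      by (simp add: coord_monomial_def on_Omega_def orbit_map_props[OF that])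
  qed (auto intro!: holomorphic_intros)
  then show ?thesis
    by (simp add: past_part_def past_entire_def coord_monomial_def)
qed

text \<open>
  On an orbit the function is a multiple of \<open>l\<close> to the power \<open>- m\<close>, and has no regular part.
\<close>

lemma past_part_coord_monomial_swap:
  assumes "0 < m"
  shows "past_part (coord_monomial m n \<circ> prod.swap) = 0"
proof -
  have "regular_part (\<lambda>l. (coord_monomial m n \<circ> prod.swap) (orbit_map l c)) \<mu> = 0" for \<mu> c
  proof (rule regular_part_unique[where r = "\<lambda>l. (c * (c + 1) * l) ^ m * c ^ n"])
    show "(coord_monomial m n \<circ> prod.swap) (orbit_map l c) = 0 + (c * (c + 1) * (1 / l)) ^ m * c ^ n"
      if "l \<noteq> 0" for l
      by (simp add: coord_monomial_def on_Omega_def orbit_map_props[OF that])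
  qed (use assms in \<open>auto intro!: holomorphic_intros\<close>)
  then show ?thesis
    by (simp add: past_part_def past_entire_def on_Omega_def fun_eq_iff)
qed

text \<open>
  By density it suffices to look at points on which \<open>a\<close>, \<open>b\<close>, \<open>c\<close> and \<open>c + 1\<close> do not vanish. On the orbit
  through such a point the exchange of the arguments is the reflection \<open>l \<mapsto> c(c + 1)/l\<close>, so
  \<open>regular_part_reflect\<close> applies.
\<close>

lemma future_part_eq:
  assumes f: "f \<in> Hol"
  shows "f - past_part f = on_Omega (\<lambda>x. past_entire (f \<circ> prod.swap) (coord_a (prod.swap x), coord_c x)
    - past_entire (f \<circ> prod.swap) (0, coord_c x))" (is "_ = ?r")
proof (rule Hol_eqI)
  let ?F = "\<lambda>q. past_entire (f \<circ> prod.swap) q - past_entire (f \<circ> prod.swap) (0, snd q)"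
  have "complex_differentiable2 ?F p" for p
    by (intro complex_differentiable2_diff complex_differentiable2_past_entire Hol_swap f
        complex_differentiable2_compose[where F = "past_entire (f \<circ> prod.swap)"]
        complex_differentiable2_const complex_differentiable2_snd)
  then have "on_Omega (\<lambda>x. ?F (coord_a x, coord_c x)) \<in> Hol"
    by (rule Hol_entire_in_coords)
  from Hol_swap[OF this] show "?r \<in> Hol"
    by (simp only: on_Omega_swap coord_c_swap snd_conv)
  show "f - past_part f \<in> Hol"
    by (intro Hol_diff past_part_Hol f)
  fix z w :: complex
  assume z: "z \<noteq> 0" and w: "w \<noteq> 0" and zw: "z * w \<noteq> 1"
  define x :: "sphere \<times> sphere" where "x = (Some z, Some w)"
  define a where "a = coord_a x"
  define c where "c = coord_c x"
  have d: "1 - z * w \<noteq> 0"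
    using zw by simp
  have "x \<in> Omega"
    using zw by (simp add: x_def)
  have a: "a \<noteq> 0"
    using z d by (simp add: a_def x_def)
  have "c + 1 = 1 / (1 - z * w)"
    using d by (simp add: c_def x_def field_simps)
  then have c: "c \<noteq> 0" "c + 1 \<noteq> 0"
    using z w d by (simp_all add: c_def x_def)
  have x: "orbit_map a c = x"
    using orbit_map_coords[OF z zw] by (simp add: a_def c_def x_def)
  then have b: "coord_a (prod.swap x) = c * (c + 1) / a"
    using orbit_map_props(4)[OF a, of c] by simp
  let ?F = "\<lambda>l. f (orbit_map l c)"
  have "regular_part (\<lambda>\<nu>. ?F (c * (c + 1) / \<nu>)) = regular_part (\<lambda>l. (f \<circ> prod.swap) (orbit_map l c))"
    by (rule ext, rule regular_part_cong) (simp add: orbit_map_swap[OF c])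
  then have "?F a = regular_part ?F a + (past_entire (f \<circ> prod.swap) (c * (c + 1) / a, c)
      - past_entire (f \<circ> prod.swap) (0, c))"
    using regular_part_reflect[OF Hol_orbit_map_holomorphic(1)[OF f], of "c * (c + 1)" a c] a c
    by (simp add: past_entire_def)
  then have "f x - past_part f x = ?r x"
    using \<open>x \<in> Omega\<close> by (simp add: x b past_part_def past_entire_def on_Omega_def flip: a_def c_def)
  then show "(f - past_part f) (Some z, Some w) = ?r (Some z, Some w)"
    by (simp add: x_def)
qed

section \<open>The decomposition\<close>

lemma sum_fun_apply: "(\<Sum>i\<in>I. f i) x = (\<Sum>i\<in>I. f i x)" for f :: "'i \<Rightarrow> 'a \<Rightarrow> complex"
  by (induction I rule: infinite_finite_induct) simp_all

lemma past_part_in_Hol_minus: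
  assumes f: "f \<in> Hol"
  shows "past_part f \<in> Hol_minus"
proof -
  let ?S = "cfun.span {fpq p q | p q. q \<le> p}"
  have mono: "coord_monomial m n \<in> ?S" for m n
  proof (rule cfun.span_base)
    have "n \<le> m + n"
      by simp
    then show "coord_monomial m n \<in> {fpq p q | p q. q \<le> p}"
      unfolding fpq_past[symmetric] by blast
  qed
  have S: "?S \<subseteq> Hol"
  proof (rule cfun.span_minimal[OF _ subspace_Hol], clarify)
    fix p q :: nat assume "q \<le> p"
    then show "fpq p q \<in> Hol"
      using fpq_past[of "p - q" q] coord_monomial_Hol by simp
  qed
  show ?thesis
    unfolding Hol_minus_def in_closure_of_Hol[OF S]
  proof (intro conjI allI impI past_part_Hol f)
    fix K and e :: real
    assume K: "compactin Omega_topology K" and "0 < e"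
    obtain M where M: "0 \<le> M" "\<And>x. x \<in> K \<Longrightarrow> norm (coord_a x) \<le> M" "\<And>x. x \<in> K \<Longrightarrow> norm (coord_c x) \<le> M"
      using coords_bounded[OF K] by metis
    obtain I a where I: "finite I" "\<And>z w. norm z \<le> M \<Longrightarrow> norm w \<le> M \<Longrightarrow>
        norm (past_entire f (z, w) - (\<Sum>(m, n)\<in>I. a m n * z ^ m * w ^ n)) < e"
      by (rule entire2_polynomial_approximation[OF complex_differentiable2_past_entire[OF f] \<open>0 < e\<close> M(1)])
        blast
    define g where "g = (\<Sum>(m, n)\<in>I. (\<lambda>x. a m n * coord_monomial m n x))"
    have "g \<in> ?S"
      unfolding g_def by (intro cfun.span_sum) (auto intro: cfun.span_scale mono)
    moreover have "norm (g x - past_part f x) < e" if "x \<in> K" for x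
    proof -
      have "x \<in> Omega"
        using compactin_Omega_subset[OF K] that by blast
      then have "g x = (\<Sum>(m, n)\<in>I. a m n * coord_a x ^ m * coord_c x ^ n)"
        by (simp add: g_def sum_fun_apply case_prod_unfold coord_monomial_def on_Omega_def mult.assoc)
      then show ?thesis
        using I(2)[OF M(2,3)[OF that]] \<open>x \<in> Omega\<close>
        by (simp add: past_part_def on_Omega_def norm_minus_commute)
    qed
    ultimately show "\<exists>g\<in>?S. \<forall>x\<in>K. norm (g x - past_part f x) < e"
      by blast
  qed
qed

text \<open>
  Subtracting from a polynomial approximation of the entire function \<open>E\<close> its value at \<open>b = 0\<close> doubles
  the error at most, and leaves only monomials that contain \<open>b\<close>.
\<close>

lemma future_part_in_Hol_plus:
  assumes f: "f \<in> Hol"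
  shows "f - past_part f \<in> Hol_plus"
proof -
  let ?S = "cfun.span {fpq p q | p q. p < q}"
  let ?E = "past_entire (f \<circ> prod.swap)"
  have mono: "coord_monomial m n \<circ> prod.swap \<in> ?S" if "0 < m" for m n
  proof (rule cfun.span_base)
    have "n < m + n"
      using that by simp
    then show "coord_monomial m n \<circ> prod.swap \<in> {fpq p q | p q. p < q}"
      unfolding fpq_future[symmetric] by blast
  qed
  have S: "?S \<subseteq> Hol"
  proof (rule cfun.span_minimal[OF _ subspace_Hol], clarify)
    fix p q :: nat assume "p < q"
    then show "fpq p q \<in> Hol"
      using fpq_future[of p "q - p"] Hol_swap[OF coord_monomial_Hol] by simp
  qed
  show ?thesis
    unfolding Hol_plus_def in_closure_of_Hol[OF S]
  proof (intro conjI allI impI Hol_diff past_part_Hol f)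
    fix K and e :: real
    assume K: "compactin Omega_topology K" and "0 < e"
    then have e: "0 < e / 2"
      by simp
    obtain M where M: "0 \<le> M" "\<And>x. x \<in> K \<Longrightarrow> norm (coord_c x) \<le> M"
      "\<And>x. x \<in> K \<Longrightarrow> norm (coord_a (prod.swap x)) \<le> M"
      using coords_bounded[OF K] by metis
    obtain I a where I: "finite I" "\<And>z w. norm z \<le> M \<Longrightarrow> norm w \<le> M \<Longrightarrow>
        norm (?E (z, w) - (\<Sum>(m, n)\<in>I. a m n * z ^ m * w ^ n)) < e / 2"
      by (rule entire2_polynomial_approximation
          [OF complex_differentiable2_past_entire[OF Hol_swap[OF f]] e M(1)]) blast
    define J where "J = {i \<in> I. 0 < fst i}"
    have "finite J"
      using I(1) by (simp add: J_def)
    \<comment> \<open>On the left the terms with \<open>m = 0\<close> cancel, because \<open>0 ^ 0 = 1\<close>; the others lose their second part.\<close>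
    have J: "(\<Sum>(m, n)\<in>I. a m n * z ^ m * w ^ n) - (\<Sum>(m, n)\<in>I. a m n * 0 ^ m * w ^ n) =
        (\<Sum>(m, n)\<in>J. a m n * z ^ m * w ^ n)" for z w
    proof -
      have "(\<Sum>(m, n)\<in>I. a m n * z ^ m * w ^ n) - (\<Sum>(m, n)\<in>I. a m n * 0 ^ m * w ^ n) =
          (\<Sum>i\<in>I. a (fst i) (snd i) * z ^ fst i * w ^ snd i - a (fst i) (snd i) * 0 ^ fst i * w ^ snd i)"
        by (simp add: case_prod_unfold sum_subtractf)
      also have "\<dots> = (\<Sum>i\<in>J. a (fst i) (snd i) * z ^ fst i * w ^ snd i - a (fst i) (snd i) * 0 ^ fst i * w ^ snd i)"
        using I(1) by (intro sum.mono_neutral_right) (auto simp: J_def)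
      also have "\<dots> = (\<Sum>(m, n)\<in>J. a m n * z ^ m * w ^ n)"
        unfolding case_prod_unfold by (intro sum.cong) (auto simp: J_def)
      finally show ?thesis .
    qed
    define g where "g = (\<Sum>(m, n)\<in>J. (\<lambda>x. a m n * (coord_monomial m n \<circ> prod.swap) x))"
    have "g \<in> ?S"
      unfolding g_def case_prod_unfold
      by (intro cfun.span_sum cfun.span_scale mono) (simp add: J_def)
    moreover have "norm (g x - (f - past_part f) x) < e" if "x \<in> K" for x
    proof -
      have "x \<in> Omega"
        using compactin_Omega_subset[OF K] that by blast
      let ?b = "coord_a (prod.swap x)" and ?c = "coord_c x"
      have "g x = (\<Sum>(m, n)\<in>J. a m n * ?b ^ m * ?c ^ n)"
        using \<open>x \<in> Omega\<close>
        by (simp add: g_def sum_fun_apply case_prod_unfold coord_monomial_def on_Omega_def mult.assoc)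
      then have "(f - past_part f) x - g x =
          (?E (?b, ?c) - (\<Sum>(m, n)\<in>I. a m n * ?b ^ m * ?c ^ n))
          - (?E (0, ?c) - (\<Sum>(m, n)\<in>I. a m n * 0 ^ m * ?c ^ n))"
        unfolding future_part_eq[OF f] using \<open>x \<in> Omega\<close> J[of ?b ?c, symmetric]
        by (simp add: on_Omega_def)
      also have "norm \<dots> < e / 2 + e / 2"
      proof (rule le_less_trans[OF norm_triangle_ineq4 add_strict_mono])
        show "norm (?E (?b, ?c) - (\<Sum>(m, n)\<in>I. a m n * ?b ^ m * ?c ^ n)) < e / 2"
          by (rule I(2)[OF M(3)[OF that] M(2)[OF that]])
        show "norm (?E (0, ?c) - (\<Sum>(m, n)\<in>I. a m n * 0 ^ m * ?c ^ n)) < e / 2"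
          by (rule I(2)[OF _ M(2)[OF that]]) (simp add: M(1))
      qed
      finally show ?thesis
        by (simp add: norm_minus_commute)
    qed
    ultimately show "\<exists>g\<in>?S. \<forall>x\<in>K. norm (g x - (f - past_part f) x) < e"
      by blast
  qed
qed

lemma subspace_past_part_eigen: "cfun.subspace {f \<in> Hol. past_part f = (\<lambda>x. r * f x)}"
proof (rule cfun.subspaceI)
  have "past_part (0 + 0) = past_part 0 + past_part 0"
    by (intro past_part_add Hol_zero)
  then have "past_part 0 = 0"
    by simp
  then show "0 \<in> {f \<in> Hol. past_part f = (\<lambda>x. r * f x)}"
    using Hol_zero by (simp add: fun_eq_iff)
next
  fix f g
  assume "f \<in> {f \<in> Hol. past_part f = (\<lambda>x. r * f x)}" "g \<in> {f \<in> Hol. past_part f = (\<lambda>x. r * f x)}"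
  then show "f + g \<in> {f \<in> Hol. past_part f = (\<lambda>x. r * f x)}"
    by (simp add: Hol_add past_part_add fun_eq_iff distrib_left)
next
  fix c f
  assume "f \<in> {f \<in> Hol. past_part f = (\<lambda>x. r * f x)}"
  then show "(\<lambda>x. c * f x) \<in> {f \<in> Hol. past_part f = (\<lambda>x. r * f x)}"
    by (simp add: Hol_cmult past_part_cmult mult.left_commute)
qed

lemma Hol_minus_eq: "Hol_minus = {f \<in> Hol. past_part f = f}"
proof (intro set_eqI iffI)
  fix f assume f: "f \<in> Hol_minus"
  let ?S = "cfun.span {fpq p q | p q. q \<le> p}"
  have "?S \<subseteq> {f \<in> Hol. past_part f = (\<lambda>x. 1 * f x)}"
  proof (rule cfun.span_minimal[OF _ subspace_past_part_eigen], clarify)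
    fix p q :: nat assume "q \<le> p"
    then have "fpq p q = coord_monomial (p - q) q"
      using fpq_past[of "p - q" q] by simp
    then show "fpq p q \<in> Hol \<and> past_part (fpq p q) = (\<lambda>x. 1 * fpq p q x)"
      by (simp add: coord_monomial_Hol past_part_coord_monomial)
  qed
  then have "?S \<subseteq> Hol" "\<And>g. g \<in> ?S \<Longrightarrow> past_part g = (\<lambda>x. 1 * g x)"
    by auto
  then show "f \<in> {f \<in> Hol. past_part f = f}"
    using past_part_closure[of ?S 1 f] f in_closure_of_Hol[of ?S f] by (simp add: Hol_minus_def)
next
  fix f assume "f \<in> {f \<in> Hol. past_part f = f}"
  then show "f \<in> Hol_minus"
    using past_part_in_Hol_minus[of f] by simp
qed

lemma Hol_plus_eq: "Hol_plus = {f \<in> Hol. past_part f = 0}"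
proof (intro set_eqI iffI)
  fix f assume f: "f \<in> Hol_plus"
  let ?S = "cfun.span {fpq p q | p q. p < q}"
  have "?S \<subseteq> {f \<in> Hol. past_part f = (\<lambda>x. 0 * f x)}"
  proof (rule cfun.span_minimal[OF _ subspace_past_part_eigen], clarify)
    fix p q :: nat assume "p < q"
    then have "fpq p q = coord_monomial (q - p) p \<circ> prod.swap" "0 < q - p"
      using fpq_future[of p "q - p"] by simp_all
    then show "fpq p q \<in> Hol \<and> past_part (fpq p q) = (\<lambda>x. 0 * fpq p q x)"
      using Hol_swap[OF coord_monomial_Hol] past_part_coord_monomial_swap by (simp add: zero_fun_def)
  qed
  then have "?S \<subseteq> Hol" "\<And>g. g \<in> ?S \<Longrightarrow> past_part g = (\<lambda>x. 0 * g x)"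
    by auto
  then show "f \<in> {f \<in> Hol. past_part f = 0}"
    using past_part_closure[of ?S 0 f] f in_closure_of_Hol[of ?S f] by (simp add: Hol_plus_def zero_fun_def)
next
  fix f assume "f \<in> {f \<in> Hol. past_part f = 0}"
  then show "f \<in> Hol_plus"
    using future_part_in_Hol_plus[of f] by simp
qed

theorem theorem4p2: "topological_direct_sum Hol_topology Hol_minus Hol_plus"
  unfolding topological_direct_sum_def
proof (intro conjI)
  let ?A = "subtopology Hol_topology Hol_minus" and ?B = "subtopology Hol_topology Hol_plus"
  show "cfun.subspace Hol_minus"
    using subspace_past_part_eigen[of 1] by (simp add: Hol_minus_eq)
  show "cfun.subspace Hol_plus"
    using subspace_past_part_eigen[of 0] by (simp add: Hol_plus_eq zero_fun_def)
  show "closedin Hol_topology Hol_minus" "closedin Hol_topology Hol_plus"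
    unfolding Hol_minus_def Hol_plus_def by (rule closedin_closure_of)+
  have "continuous_map Hol_topology Hol_topology (\<lambda>f. f - past_part f)"
  proof (rule continuous_map_into_Hol_topology)
    fix f K and e :: real
    assume "f \<in> topspace Hol_topology"
    then have f: "f \<in> Hol"
      by (simp add: topspace_Hol_topology)
    assume K: "compactin Omega_topology K" and "0 < e"
    let ?U = "hol_ball f K (e / 2) \<inter> {g \<in> topspace Hol_topology. past_part g \<in> hol_ball (past_part f) K (e / 2)}"
    have "openin Hol_topology ?U"
      by (intro openin_Int openin_hol_ball f K past_part_Hol
          openin_continuous_map_preimage[OF continuous_map_past_part])
    moreover have "f \<in> ?U"
      using f \<open>0 < e\<close> by (simp add: in_hol_ball_self topspace_Hol_topology past_part_Hol)
    moreover have "norm ((g - past_part g) x - (f - past_part f) x) < e" if "g \<in> ?U" "x \<in> K" for g x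
    proof -
      have "norm (g x - f x) < e / 2" "norm (past_part g x - past_part f x) < e / 2"
        using that by (auto simp: hol_ball_def)
      moreover have eq: "(g - past_part g) x - (f - past_part f) x = (g x - f x) - (past_part g x - past_part f x)"
        by simp
      ultimately show ?thesis
        unfolding eq using norm_triangle_ineq4[of "g x - f x" "past_part g x - past_part f x"] by linarith
    qed
    ultimately show "\<exists>U. openin Hol_topology U \<and> f \<in> U \<and>
        (\<forall>g\<in>U. \<forall>x\<in>K. norm ((g - past_part g) x - (f - past_part f) x) < e)"
      by blast
  qed (simp add: topspace_Hol_topology past_part_Hol Hol_diff)
  then have "continuous_map Hol_topology (prod_topology ?A ?B) (\<lambda>f. (past_part f, f - past_part f))"
    by (intro continuous_map_pairedI)
      (auto simp: continuous_map_in_subtopology continuous_map_past_part topspace_Hol_topology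
        past_part_in_Hol_minus future_part_in_Hol_plus)
  moreover have "continuous_map (prod_topology ?A ?B) Hol_topology (\<lambda>(f, g). f + g)"
    by (rule continuous_map_Hol_add) (auto simp: Hol_minus_eq Hol_plus_eq)
  ultimately have "homeomorphic_maps (prod_topology ?A ?B) Hol_topology (\<lambda>(f, g). f + g)
      (\<lambda>f. (past_part f, f - past_part f))"
    unfolding homeomorphic_maps_def
    by (auto simp: Hol_minus_eq Hol_plus_eq past_part_add)
  then show "homeomorphic_map (prod_topology ?A ?B) Hol_topology (\<lambda>(f, g). f + g)"
    by (auto simp: homeomorphic_map_maps)
qed

end
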